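(* Let $X$ be a metrizable space. The following statements are equivalent: (1) $X$ is metrizable by a uniformly completely paracompact metric; (2) $X$ is strongly metrizable and $nlc(X)$ is compact; (3) $X$ is metrizable by a metric which is Bourbaki-complete and cofinally complete at the same time.
   Context: "Metrizable by a metric $d$" means that $d$ induces the topology of $X$. For a metric space $(X,d)$, the metric uniformity $\mu_d$ is the family of covers of $X$ (uniform covers) refined by $\{B_d(x,\varepsilon):x\in X\}$ for some $\varepsilon>0$; a property of uniform spaces is attributed to the metric $d$ when $(X,\mu_d)$ has it. For a cover $\mathcal U$ of $X$ and $A\subset X$: $St(A,\mathcal U)=\bigcup\{U\in\mathcal U: U\cap A\neq\emptyset\}$, $St^0(A,\mathcal U)=A$, $St^m(A,\mathcal U)=St(St^{m-1}(A,\mathcal U),\mathcal U)$ for $m\geq 1$. In a uniform space $(X,\mu)$, a filter $\mathcal F$ is Bourbaki-Cauchy if for every $\mathcal U\in\mu$ there are $m\in\mathbb N$, $U\in\mathcal U$ and $F\in\mathcal F$ with $F\subset St^m(U,\mathcal U)$; it is cofinally Cauchy if for every $\mathcal U\in\mu$ there is $U\in\mathcal U$ with $F\cap U\neq\emptyset$ for all $F\in\mathcal F$. $(X,\mu)$ is Bourbaki-complete (respectively cofinally complete) if every Bourbaki-Cauchy (respectively cofinally Cauchy) filter has a cluster point. A cover is star-finite if each of its members meets at most finitely many of its members. An open cover $\mathcal U$ of $X$ is $\sigma$-star-finite if there are countably many star-finite open covers $\mathcal U_n$, $n\in\mathbb N$, of $X$ with $\mathcal U\subset\bigcup_{n}\mathcal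 U_n$. A uniform space $(X,\mu)$ is uniformly completely paracompact if it is cofinally complete and $\mu$ has a base of $\sigma$-star-finite open covers. $X$ is strongly metrizable if it has a base for the topology which is the union of countably many star-finite open covers of $X$. $nlc(X)$ is the set of points of $X$ having no compact neighborhood in $X$ (possibly empty). *)

theory Defs
  imports "HOL-Analysis.Analysis"
begin

definition cover_of :: "'a set \<Rightarrow> 'a set set \<Rightarrow> bool" where
  "cover_of S \<U> \<longleftrightarrow> \<U> \<subseteq> Pow S \<and> \<Union>\<U> = S"

definition refines :: "'a set set \<Rightarrow> 'a set set \<Rightarrow> bool" where
  "refines \<V> \<U> \<longleftrightarrow> (\<forall>V\<in>\<V>. \<exists>U\<in>\<U>. V \<subseteq> U)"

definition star :: "'a set set \<Rightarrow> 'a set \<Rightarrow> 'a set" where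
  "star \<U> A = \<Union>{U \<in> \<U>. U \<inter> A \<noteq> {}}"

text \<open>The iterated star \<open>St\<^sup>m(A, \<U>)\<close> is written \<open>(star \<U> ^^ m) A\<close>.\<close>

text \<open>A uniform space is a carrier set \<open>S\<close> together with a family \<open>\<mu>\<close> of covers of \<open>S\<close>
  (the uniform covers).\<close>

definition metric_uniformity :: "'a set \<Rightarrow> ('a \<Rightarrow> 'a \<Rightarrow> real) \<Rightarrow> 'a set set set" where
  "metric_uniformity S d =
     {\<U>. cover_of S \<U> \<and> (\<exists>\<epsilon>>0. refines {Metric_space.mball S d x \<epsilon> |x. x \<in> S} \<U>)}"

definition uniform_topology :: "'a set \<Rightarrow> 'a set set set \<Rightarrow> 'a topology" where
  "uniform_topology S \<mu> =
     topology (\<lambda>G. G \<subseteq> S \<and> (\<forall>x\<in>G. \<exists>\<U>\<in>\<mu>. star \<U> {x} \<subseteq> G))"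

text \<open>The argument of \<^const>\<open>topology\<close> above is indeed a topology in the case of interest:
  the metric uniformity induces the metric topology.\<close>

lemma uniform_topology_metric_uniformity:
  assumes "Metric_space S d"
  shows "uniform_topology S (metric_uniformity S d) = Metric_space.mtopology S d"
proof -
  interpret Metric_space S d by (rule assms)
  have "(G \<subseteq> S \<and> (\<forall>x\<in>G. \<exists>\<U>\<in>metric_uniformity S d. star \<U> {x} \<subseteq> G))
        \<longleftrightarrow> openin mtopology G" for G
  proof
    assume G: "G \<subseteq> S \<and> (\<forall>x\<in>G. \<exists>\<U>\<in>metric_uniformity S d. star \<U> {x} \<subseteq> G)"
    have "\<exists>r>0. mball x r \<subseteq> G" if x: "x \<in> G" for x
    proof -
      obtain \<U> where \<U>: "\<U> \<in> metric_uniformity S d" "star \<U> {x} \<subseteq> G"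
        using G x by blast
      then obtain \<epsilon> where \<epsilon>: "\<epsilon> > 0" "refines {mball y \<epsilon> |y. y \<in> S} \<U>"
        by (auto simp: metric_uniformity_def)
      have "x \<in> S" using G x by blast
      then obtain U where "U \<in> \<U>" "mball x \<epsilon> \<subseteq> U"
        using \<epsilon>(2) unfolding refines_def by blast
      moreover have "x \<in> mball x \<epsilon>" using \<open>x \<in> S\<close> \<epsilon>(1) by simp
      ultimately have "mball x \<epsilon> \<subseteq> star \<U> {x}" unfolding star_def by blast
      then show ?thesis using \<U>(2) \<epsilon>(1) by blast
    qed
    then show "openin mtopology G" using G by (auto simp: openin_mtopology)
  next
    assume G: "openin mtopology G"
    have "\<exists>\<U>\<in>metric_uniformity S d. star \<U> {x} \<subseteq> G" if x: "x \<in> G" for x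
    proof -
      obtain r where r: "r > 0" "mball x r \<subseteq> G"
        using G x by (auto simp: openin_mtopology)
      define \<U> where "\<U> = {mball y (r/2) |y. y \<in> S}"
      have "cover_of S \<U>"
        using r(1) unfolding cover_of_def \<U>_def by force
      moreover have "refines {mball y (r/2) |y. y \<in> S} \<U>"
        unfolding refines_def \<U>_def by blast
      ultimately have "\<U> \<in> metric_uniformity S d"
        using r(1) unfolding metric_uniformity_def by (auto intro!: exI[of _ "r/2"])
      moreover have "star \<U> {x} \<subseteq> mball x r"
      proof
        fix z assume "z \<in> star \<U> {x}"
        then obtain y where y: "y \<in> S" "x \<in> S" "z \<in> S" "d y x < r/2" "d y z < r/2"
          unfolding star_def \<U>_def by auto
        then have "d x z < r" using triangle[of x y z] commute[of x y] by linarith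
        then show "z \<in> mball x r" using y by simp
      qed
      ultimately show ?thesis using r(2) by blast
    qed
    then show "G \<subseteq> S \<and> (\<forall>x\<in>G. \<exists>\<U>\<in>metric_uniformity S d. star \<U> {x} \<subseteq> G)"
      using openin_subset[OF G] by auto
  qed
  then show ?thesis
    unfolding uniform_topology_def by (simp add: openin_inverse)
qed

text \<open>Filters on \<open>S\<close> are proper filters on the ambient type that contain \<open>S\<close>; a set \<open>F\<close>
  belongs to the filter \<open>\<F>\<close> iff \<open>eventually (\<lambda>x. x \<in> F) \<F>\<close>.\<close>

definition filter_on :: "'a set \<Rightarrow> 'a filter \<Rightarrow> bool" where
  "filter_on S \<F> \<longleftrightarrow> \<F> \<noteq> bot \<and> eventually (\<lambda>x. x \<in> S) \<F>"

definition filter_sets :: "'a filter \<Rightarrow> 'a set set" where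
  "filter_sets \<F> = {F. eventually (\<lambda>x. x \<in> F) \<F>}"

definition cluster_point :: "'a topology \<Rightarrow> 'a filter \<Rightarrow> 'a \<Rightarrow> bool" where
  "cluster_point T \<F> x \<longleftrightarrow> x \<in> topspace T \<and> (\<forall>F\<in>filter_sets \<F>. x \<in> T closure_of F)"

definition Bourbaki_Cauchy :: "'a set set set \<Rightarrow> 'a filter \<Rightarrow> bool" where
  "Bourbaki_Cauchy \<mu> \<F> \<longleftrightarrow>
     (\<forall>\<U>\<in>\<mu>. \<exists>m. \<exists>U\<in>\<U>. \<exists>F\<in>filter_sets \<F>. F \<subseteq> (star \<U> ^^ m) U)"

definition cofinally_Cauchy :: "'a set set set \<Rightarrow> 'a filter \<Rightarrow> bool" where
  "cofinally_Cauchy \<mu> \<F> \<longleftrightarrow>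
     (\<forall>\<U>\<in>\<mu>. \<exists>U\<in>\<U>. \<forall>F\<in>filter_sets \<F>. F \<inter> U \<noteq> {})"

definition Bourbaki_complete :: "'a set \<Rightarrow> 'a set set set \<Rightarrow> bool" where
  "Bourbaki_complete S \<mu> \<longleftrightarrow>
     (\<forall>\<F>. filter_on S \<F> \<and> Bourbaki_Cauchy \<mu> \<F> \<longrightarrow>
        (\<exists>x. cluster_point (uniform_topology S \<mu>) \<F> x))"

definition cofinally_complete :: "'a set \<Rightarrow> 'a set set set \<Rightarrow> bool" where
  "cofinally_complete S \<mu> \<longleftrightarrow>
     (\<forall>\<F>. filter_on S \<F> \<and> cofinally_Cauchy \<mu> \<F> \<longrightarrow>
        (\<exists>x. cluster_point (uniform_topology S \<mu>) \<F> x))"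

definition open_cover_of :: "'a topology \<Rightarrow> 'a set set \<Rightarrow> bool" where
  "open_cover_of T \<U> \<longleftrightarrow> cover_of (topspace T) \<U> \<and> (\<forall>U\<in>\<U>. openin T U)"

definition star_finite :: "'a set set \<Rightarrow> bool" where
  "star_finite \<U> \<longleftrightarrow> (\<forall>U\<in>\<U>. finite {V \<in> \<U>. V \<inter> U \<noteq> {}})"

definition sigma_star_finite :: "'a topology \<Rightarrow> 'a set set \<Rightarrow> bool" where
  "sigma_star_finite T \<U> \<longleftrightarrow>
     (\<exists>\<V> :: nat \<Rightarrow> 'a set set.
        (\<forall>n. open_cover_of T (\<V> n) \<and> star_finite (\<V> n)) \<and> \<U> \<subseteq> (\<Union>n. \<V> n))"

definition uniformity_base :: "'a set set set \<Rightarrow> 'a set set set \<Rightarrow> bool" where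
  "uniformity_base \<mu> \<B> \<longleftrightarrow> \<B> \<subseteq> \<mu> \<and> (\<forall>\<U>\<in>\<mu>. \<exists>\<V>\<in>\<B>. refines \<V> \<U>)"

definition uniformly_completely_paracompact :: "'a set \<Rightarrow> 'a set set set \<Rightarrow> bool" where
  "uniformly_completely_paracompact S \<mu> \<longleftrightarrow>
     cofinally_complete S \<mu> \<and>
     (\<exists>\<B>. uniformity_base \<mu> \<B> \<and>
        (\<forall>\<U>\<in>\<B>. open_cover_of (uniform_topology S \<mu>) \<U> \<and>
                 sigma_star_finite (uniform_topology S \<mu>) \<U>))"

definition metrizes :: "('a \<Rightarrow> 'a \<Rightarrow> real) \<Rightarrow> 'a topology \<Rightarrow> bool" where
  "metrizes d X \<longleftrightarrow>
     Metric_space (topspace X) d \<and> Metric_space.mtopology (topspace X) d = X"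

text \<open>That a family \<open>\<B>\<close> is a base of \<open>X\<close> is expressed by
  \<open>openin X = arbitrary union_of (\<lambda>U. U \<in> \<B>)\<close>: the open sets are exactly the unions of
  subfamilies of \<open>\<B>\<close>.\<close>

definition strongly_metrizable :: "'a topology \<Rightarrow> bool" where
  "strongly_metrizable X \<longleftrightarrow>
     (\<exists>\<U> :: nat \<Rightarrow> 'a set set.
        (\<forall>n. open_cover_of X (\<U> n) \<and> star_finite (\<U> n)) \<and>
        openin X = arbitrary union_of (\<lambda>U. U \<in> (\<Union>n. \<U> n)))"

definition nlc :: "'a topology \<Rightarrow> 'a set" where
  "nlc X = {x \<in> topspace X. \<not> (\<exists>U K. openin X U \<and> compactin X K \<and> x \<in> U \<and> U \<subseteq> K)}"

end

theory Submission
  imports Defs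
begin

text \<open>
  Write \<open>K\<close> for the set \<^term>\<open>nlc X\<close> of points without compact neighbourhood.

  A cofinally complete metric forces \<open>K\<close> to be compact: around the points of a sequence in \<open>K\<close>
  without cluster point, noncompact balls of radii tending to 0 carry filters without cluster
  point, and the supremum of these filters is cofinally Cauchy
  (\<open>compact_nlc_if_cofinally_complete\<close>).  Strong metrizability is immediate from a base of
  sigma-star-finite uniform covers, because the metric uniformity has a countable base.  For a
  Bourbaki-complete metric, consider for each \<open>n\<close> the star-finite cover by rings of
  \<open>1 / (n + 1)\<close>-chains about one base point in every chain component.  A decreasing sequence of
  intersections of members of these covers must eventually be covered by finitely many balls of
  any given radius, since otherwise removing finite unions of such balls would yield a
  Bourbaki-Cauchy filter without cluster point; cutting the members of the common refinements
  with those finitely many balls gives star-finite covers whose union is a base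
  (\<open>strongly_metrizable_if_Bourbaki_complete\<close>).

  Conversely, let \<open>X\<close> be strongly metrizable with \<open>K\<close> compact, and let \<open>\<U> n\<close> be nested
  star-finite covers whose union is a base.  Every countable family of open covers is uniform for a
  suitable compatible metric (\<open>countable_open_covers_uniform\<close>).  Apply this to the covers \<open>\<U> n\<close>,
  to the covers consisting of a basic neighbourhood \<open>V k\<close> of \<open>K\<close> and all relatively compact open
  sets, and to star-finite covers subordinate to the exhaustion of \<open>X\<close> by the unions of those
  members of \<open>\<U> n\<close> that are relatively compact off \<open>V k\<close>.  A filter without cluster point
  in \<open>K\<close> eventually avoids some \<open>V k\<close>; if it is cofinally Cauchy it then meets a relatively
  compact set, and if it is Bourbaki-Cauchy it contains a finite union of relatively compact sets,
  so it has a cluster point in either case.  The resulting metric therefore serves for both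
  completeness properties, and its uniformity has a base of sigma-star-finite uniform covers
  (\<open>sigma_star_finite_uniform_cover\<close>).
\<close>

section \<open>Star-finite covers\<close>

lemma open_cover_ofI:
  assumes "\<And>U. U \<in> \<U> \<Longrightarrow> openin X U" "\<And>x. x \<in> topspace X \<Longrightarrow> \<exists>U\<in>\<U>. x \<in> U"
  shows "open_cover_of X \<U>"
  using assms openin_subset unfolding open_cover_of_def cover_of_def by fast

lemma open_cover_ofD:
  assumes "open_cover_of X \<U>"
  shows "U \<in> \<U> \<Longrightarrow> openin X U" "x \<in> topspace X \<Longrightarrow> \<exists>U\<in>\<U>. x \<in> U"
  using assms unfolding open_cover_of_def cover_of_def by auto

lemma finite_star_finite_meeting_compact:
  assumes \<U>: "open_cover_of X \<U>" "star_finite \<U>" and S: "compactin X S"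
  shows "finite {U \<in> \<U>. U \<inter> S \<noteq> {}}"
proof -
  have "S \<subseteq> \<Union>\<U>"
    using compactin_subset_topspace[OF S] \<U>(1) unfolding open_cover_of_def cover_of_def by auto
  then obtain \<F> where \<F>: "finite \<F>" "\<F> \<subseteq> \<U>" "S \<subseteq> \<Union>\<F>"
    using S open_cover_ofD(1)[OF \<U>(1)] unfolding compactin_def by meson
  have "{U \<in> \<U>. U \<inter> S \<noteq> {}} \<subseteq> (\<Union>V\<in>\<F>. {U \<in> \<U>. U \<inter> V \<noteq> {}})"
    using \<F>(3) by blast
  moreover have "finite (\<Union>V\<in>\<F>. {U \<in> \<U>. U \<inter> V \<noteq> {}})"
    using \<F> \<U>(2) unfolding star_finite_def by blast
  ultimately show ?thesis by (rule finite_subset)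
qed

lemma star_mono: "A \<subseteq> B \<Longrightarrow> star \<U> A \<subseteq> star \<U> B"
  unfolding star_def by blast

lemma star_refines: "refines \<V> \<U> \<Longrightarrow> star \<V> A \<subseteq> star \<U> A"
  unfolding star_def refines_def by blast

lemma star_pow_mono:
  assumes "refines \<V> \<U>" "A \<subseteq> B"
  shows "(star \<V> ^^ m) A \<subseteq> (star \<U> ^^ m) B"
proof (induction m)
  case (Suc m)
  then show ?case
    using star_mono[OF Suc.IH, of \<U>] star_refines[OF assms(1), of "(star \<V> ^^ m) A"] by auto
qed (use assms in auto)

text \<open>Iterated stars of members of a star-finite cover are covered by finitely many members;
  hence a Bourbaki-Cauchy filter contains a finite union of members of every star-finite uniform
  cover.\<close>

lemma star_pow_finite_subcover:
  assumes "star_finite \<U>" "U \<in> \<U>"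
  shows "\<exists>\<T>\<subseteq>\<U>. finite \<T> \<and> (star \<U> ^^ m) U \<subseteq> \<Union>\<T>"
proof (induction m)
  case 0
  show ?case using assms(2) by (intro exI[of _ "{U}"]) auto
next
  case (Suc m)
  then obtain \<T> where \<T>: "\<T> \<subseteq> \<U>" "finite \<T>" "(star \<U> ^^ m) U \<subseteq> \<Union>\<T>" by blast
  let ?S = "\<Union>T\<in>\<T>. {V \<in> \<U>. V \<inter> T \<noteq> {}}"
  have "finite ?S" using \<T> assms(1) unfolding star_finite_def by blast
  moreover have "(star \<U> ^^ Suc m) U \<subseteq> star \<U> (\<Union>\<T>)"
    using star_mono[OF \<T>(3), of \<U>] by simp
  moreover have "star \<U> (\<Union>\<T>) \<subseteq> \<Union>?S"
    unfolding star_def by blast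
  moreover have "?S \<subseteq> \<U>" by blast
  ultimately show ?case by (meson order_trans)
qed

lemma Bourbaki_Cauchy_star_finite:
  assumes "Bourbaki_Cauchy \<mu> \<F>" "\<U> \<in> \<mu>" "star_finite \<U>"
  shows "\<exists>\<T>\<subseteq>\<U>. finite \<T> \<and> eventually (\<lambda>x. x \<in> \<Union>\<T>) \<F>"
proof -
  obtain m U F where mUF: "U \<in> \<U>" "F \<in> filter_sets \<F>" "F \<subseteq> (star \<U> ^^ m) U"
    using assms(1,2) unfolding Bourbaki_Cauchy_def by blast
  obtain \<T> where \<T>: "\<T> \<subseteq> \<U>" "finite \<T>" "(star \<U> ^^ m) U \<subseteq> \<Union>\<T>"
    using star_pow_finite_subcover[OF assms(3) mUF(1), of m] by (elim exE conjE)
  have "eventually (\<lambda>x. x \<in> F) \<F>" using mUF(2) unfolding filter_sets_def by simp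
  then have "eventually (\<lambda>x. x \<in> \<Union>\<T>) \<F>"
    by (rule eventually_mono) (use order_trans[OF mUF(3) \<T>(3)] in auto)
  then show ?thesis using \<T> by blast
qed

text \<open>Replacing every member of a star-finite cover by finitely many open sets with the same
  union leaves the cover star-finite.\<close>

lemma star_finite_subdivide:
  assumes \<U>: "open_cover_of X \<U>" "star_finite \<U>"
    and P: "\<And>U. U \<in> \<U> \<Longrightarrow> finite (P U)" "\<And>U. U \<in> \<U> \<Longrightarrow> \<Union>(P U) = U"
      "\<And>U V. U \<in> \<U> \<Longrightarrow> V \<in> P U \<Longrightarrow> openin X V"
  shows "open_cover_of X (\<Union>U\<in>\<U>. P U)" "star_finite (\<Union>U\<in>\<U>. P U)"
proof -
  show "open_cover_of X (\<Union>U\<in>\<U>. P U)"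
  proof (rule open_cover_ofI)
    fix x assume "x \<in> topspace X"
    then obtain U where "U \<in> \<U>" "x \<in> U" using open_cover_ofD(2)[OF \<U>(1)] by blast
    then show "\<exists>V\<in>\<Union>U\<in>\<U>. P U. x \<in> V" using P(2)[of U] by (metis UN_iff UnionE)
  qed (use P(3) in auto)
  show "star_finite (\<Union>U\<in>\<U>. P U)"
    unfolding star_finite_def
  proof
    fix V assume "V \<in> (\<Union>U\<in>\<U>. P U)"
    then obtain U where U: "U \<in> \<U>" "V \<in> P U" by blast
    have "{W \<in> \<Union>U\<in>\<U>. P U. W \<inter> V \<noteq> {}} \<subseteq> (\<Union>U'\<in>{U' \<in> \<U>. U' \<inter> U \<noteq> {}}. P U')"
      using U P(2) by blast
    moreover have "finite (\<Union>U'\<in>{U' \<in> \<U>. U' \<inter> U \<noteq> {}}. P U')"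
      using U(1) \<U>(2) P(1) unfolding star_finite_def by blast
    ultimately show "finite {W \<in> \<Union>U\<in>\<U>. P U. W \<inter> V \<noteq> {}}" by (rule finite_subset)
  qed
qed

text \<open>The common refinement of the first covers of a sequence: all intersections of one
  member from each of the covers with index at most \<open>n\<close>.\<close>

primrec common_refinement :: "(nat \<Rightarrow> 'a set set) \<Rightarrow> nat \<Rightarrow> 'a set set" where
  "common_refinement \<U> 0 = \<U> 0"
| "common_refinement \<U> (Suc n) = {E \<inter> U |E U. E \<in> common_refinement \<U> n \<and> U \<in> \<U> (Suc n)}"

lemma common_refinement_SucI:
  "E \<in> common_refinement \<U> n \<Longrightarrow> U \<in> \<U> (Suc n) \<Longrightarrow> E \<inter> U \<in> common_refinement \<U> (Suc n)"
  unfolding common_refinement.simps by blast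

lemma common_refinement_open_cover:
  assumes "\<And>n. open_cover_of X (\<U> n)"
  shows "open_cover_of X (common_refinement \<U> n)"
proof (induction n)
  case (Suc n)
  show ?case
  proof (rule open_cover_ofI)
    fix x assume "x \<in> topspace X"
    then obtain E U where "E \<in> common_refinement \<U> n" "U \<in> \<U> (Suc n)" "x \<in> E" "x \<in> U"
      using open_cover_ofD(2)[OF Suc] open_cover_ofD(2)[OF assms] by blast
    then show "\<exists>W\<in>common_refinement \<U> (Suc n). x \<in> W"
      using common_refinement_SucI[of E \<U> n U] by (intro bexI[of _ "E \<inter> U"]) simp_all
  qed (use open_cover_ofD(1)[OF Suc] open_cover_ofD(1)[OF assms] in auto)
qed (use assms in simp)

lemma common_refinement_star_finite:
  assumes "\<And>n. star_finite (\<U> n)"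
  shows "star_finite (common_refinement \<U> n)"
proof (induction n)
  case (Suc n)
  show ?case
    unfolding star_finite_def
  proof
    fix W assume "W \<in> common_refinement \<U> (Suc n)"
    then obtain E U where W: "W = E \<inter> U" "E \<in> common_refinement \<U> n" "U \<in> \<U> (Suc n)" by auto
    let ?A = "{E' \<in> common_refinement \<U> n. E' \<inter> E \<noteq> {}}"
    let ?B = "{U' \<in> \<U> (Suc n). U' \<inter> U \<noteq> {}}"
    have "{V \<in> common_refinement \<U> (Suc n). V \<inter> W \<noteq> {}} \<subseteq> (\<lambda>(E', U'). E' \<inter> U') ` (?A \<times> ?B)"
      using W(1) by auto
    moreover have "finite ((\<lambda>(E', U'). E' \<inter> U') ` (?A \<times> ?B))"
      using Suc assms W unfolding star_finite_def by blast
    ultimately show "finite {V \<in> common_refinement \<U> (Suc n). V \<inter> W \<noteq> {}}"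
      by (rule finite_subset)
  qed
qed (use assms in simp)

lemma common_refinement_below:
  assumes "\<And>n. open_cover_of X (\<U> n)" "U \<in> \<U> n" "x \<in> U"
  shows "\<exists>E\<in>common_refinement \<U> n. x \<in> E \<and> E \<subseteq> U"
proof (cases n)
  case (Suc m)
  have "x \<in> topspace X" using assms openin_subset[OF open_cover_ofD(1)[OF assms(1,2)]] by blast
  then obtain E where "E \<in> common_refinement \<U> m" "x \<in> E"
    using open_cover_ofD(2)[OF common_refinement_open_cover[of X \<U>, OF assms(1)]] by blast
  then show ?thesis
    using Suc assms(2,3) common_refinement_SucI[of E \<U> m U]
    by (intro bexI[of _ "E \<inter> U"]) simp_all
qed (use assms in auto)

lemma common_refinement_Suc_below:
  assumes "\<And>n. open_cover_of X (\<U> n)" "E \<in> common_refinement \<U> n" "x \<in> E"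
  shows "\<exists>E'\<in>common_refinement \<U> (Suc n). x \<in> E' \<and> E' \<subseteq> E"
proof -
  have "x \<in> topspace X"
    using assms(3) openin_subset[OF open_cover_ofD(1)[OF common_refinement_open_cover[of X \<U>, OF assms(1)] assms(2)]]
    by blast
  then obtain U where "U \<in> \<U> (Suc n)" "x \<in> U"
    using open_cover_ofD(2)[OF assms(1)] by blast
  then show ?thesis
    using assms(2,3) common_refinement_SucI[of E \<U> n U] by (intro bexI[of _ "E \<inter> U"]) simp_all
qed

lemma Inter_in_common_refinement:
  assumes "\<And>i. G i \<in> \<U> i"
  shows "(\<Inter>i\<le>n. G i) \<in> common_refinement \<U> n"
proof (induction n)
  case (Suc n)
  have "(\<Inter>i\<le>Suc n. G i) = (\<Inter>i\<le>n. G i) \<inter> G (Suc n)"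
    by (simp add: atMost_Suc Int_commute)
  then show ?case using common_refinement_SucI[OF Suc assms] by simp
qed (simp add: assms)

lemma strongly_metrizableI:
  fixes \<V> :: "nat \<Rightarrow> nat \<Rightarrow> 'a set set"
  assumes "\<And>n k. open_cover_of X (\<V> n k)" "\<And>n k. star_finite (\<V> n k)"
    and base: "\<And>G x. openin X G \<Longrightarrow> x \<in> G \<Longrightarrow> \<exists>n k. \<exists>V\<in>\<V> n k. x \<in> V \<and> V \<subseteq> G"
  shows "strongly_metrizable X"
proof -
  define \<U> where "\<U> = (\<lambda>n. case prod_decode n of (i, j) \<Rightarrow> \<V> i j)"
  have \<U>: "\<U> (prod_encode (i, j)) = \<V> i j" for i j unfolding \<U>_def by simp
  have "openin X = arbitrary union_of (\<lambda>U. U \<in> (\<Union>n. \<U> n))"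
    unfolding openin_topology_base_unique
  proof (intro conjI allI impI)
    fix V assume "V \<in> (\<Union>n. \<U> n)"
    then obtain n where "V \<in> \<U> n" by blast
    then show "openin X V"
      unfolding \<U>_def using open_cover_ofD(1)[OF assms(1)] by (cases "prod_decode n") auto
  next
    fix G x assume "openin X G \<and> x \<in> G"
    then obtain n k V where "V \<in> \<V> n k" "x \<in> V" "V \<subseteq> G" using base by blast
    then have "V \<in> (\<Union>n. \<U> n)" using \<U>[of n k] by blast
    then show "\<exists>V. V \<in> (\<Union>n. \<U> n) \<and> x \<in> V \<and> V \<subseteq> G" using \<open>x \<in> V\<close> \<open>V \<subseteq> G\<close> by blast
  qed
  moreover have "open_cover_of X (\<U> n) \<and> star_finite (\<U> n)" for n
    using assms(1,2) unfolding \<U>_def by (auto split: prod.splits)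
  ultimately show ?thesis unfolding strongly_metrizable_def by blast
qed

text \<open>The star-finite covers of a strongly metrizable space can be taken nested.\<close>

lemma strongly_metrizableE:
  assumes "strongly_metrizable X"
  obtains \<U> :: "nat \<Rightarrow> 'a set set"
  where "\<And>n. open_cover_of X (\<U> n)" "\<And>n. star_finite (\<U> n)"
    "\<And>n E x. E \<in> \<U> n \<Longrightarrow> x \<in> E \<Longrightarrow> \<exists>E'\<in>\<U> (Suc n). x \<in> E' \<and> E' \<subseteq> E"
    "\<And>G x. openin X G \<Longrightarrow> x \<in> G \<Longrightarrow> \<exists>n. \<exists>E\<in>\<U> n. x \<in> E \<and> E \<subseteq> G"
proof -
  obtain \<U> :: "nat \<Rightarrow> 'a set set"
    where \<U>: "\<And>n. open_cover_of X (\<U> n)" "\<And>n. star_finite (\<U> n)"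
      "openin X = arbitrary union_of (\<lambda>U. U \<in> (\<Union>n. \<U> n))"
    using assms unfolding strongly_metrizable_def by blast
  show ?thesis
  proof (rule that[of "common_refinement \<U>"])
    fix G x assume G: "openin X G" "x \<in> G"
    have "\<forall>G x. openin X G \<and> x \<in> G \<longrightarrow> (\<exists>U. U \<in> (\<Union>n. \<U> n) \<and> x \<in> U \<and> U \<subseteq> G)"
      by (rule iffD1[OF openin_topology_base_unique \<U>(3), THEN conjunct2])
    then have "\<exists>U. U \<in> (\<Union>n. \<U> n) \<and> x \<in> U \<and> U \<subseteq> G" using G by (elim allE impE) (rule conjI)
    then obtain U where "U \<in> (\<Union>n. \<U> n)" "x \<in> U" "U \<subseteq> G" by (elim exE conjE)
    then obtain n where "U \<in> \<U> n" "x \<in> U" "U \<subseteq> G" by blast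
    then show "\<exists>n. \<exists>E\<in>common_refinement \<U> n. x \<in> E \<and> E \<subseteq> G"
      using common_refinement_below[of X \<U> U n x, OF \<U>(1)] by (meson order_trans)
  next
    show "\<exists>E'\<in>common_refinement \<U> (Suc n). x \<in> E' \<and> E' \<subseteq> E"
      if "E \<in> common_refinement \<U> n" "x \<in> E" for n E x
      by (rule common_refinement_Suc_below[of X \<U>, OF \<U>(1) that])
  qed (rule common_refinement_open_cover common_refinement_star_finite, rule \<U>)+
qed

section \<open>Cluster points\<close>

lemma cluster_pointD:
  assumes "cluster_point T \<F> x" "openin T G" "x \<in> G"
  shows "\<not> eventually (\<lambda>y. y \<notin> G) \<F>"
proof
  assume "eventually (\<lambda>y. y \<notin> G) \<F>"
  then have "x \<in> T closure_of {y. y \<notin> G}"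
    using assms(1) unfolding cluster_point_def filter_sets_def by auto
  then show False using assms(2,3) by (auto simp: in_closure_of)
qed

lemma not_cluster_pointD:
  assumes "\<not> cluster_point T \<F> x" "x \<in> topspace T"
  shows "\<exists>G. openin T G \<and> x \<in> G \<and> eventually (\<lambda>y. y \<notin> G) \<F>"
proof -
  obtain F where F: "eventually (\<lambda>y. y \<in> F) \<F>" "x \<notin> T closure_of F"
    using assms unfolding cluster_point_def filter_sets_def by blast
  then obtain G where G: "openin T G" "x \<in> G" "G \<inter> F = {}"
    using assms(2) by (auto simp: in_closure_of)
  have "eventually (\<lambda>y. y \<notin> G) \<F>" using F(1) by (rule eventually_mono) (use G in blast)
  then show ?thesis using G by blast
qed

lemma no_cluster_point_in_compact:
  assumes S: "compactin T S" and no: "\<And>x. x \<in> S \<Longrightarrow> \<not> cluster_point T \<F> x"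
  shows "\<exists>G. openin T G \<and> S \<subseteq> G \<and> eventually (\<lambda>y. y \<notin> G) \<F>"
proof -
  let ?\<G> = "{G. openin T G \<and> eventually (\<lambda>y. y \<notin> G) \<F>}"
  have "S \<subseteq> \<Union>?\<G>"
    using not_cluster_pointD[OF no] compactin_subset_topspace[OF S] by blast
  then obtain \<H> where \<H>: "finite \<H>" "\<H> \<subseteq> ?\<G>" "S \<subseteq> \<Union>\<H>"
    using S unfolding compactin_def by (metis (no_types, lifting) mem_Collect_eq)
  have "eventually (\<lambda>y. \<forall>G\<in>\<H>. y \<notin> G) \<F>"
    using \<H> by (auto simp: eventually_ball_finite_distrib)
  then have "eventually (\<lambda>y. y \<notin> \<Union>\<H>) \<F>" by (rule eventually_mono) blast
  moreover have "openin T (\<Union>\<H>)" using \<H> by blast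
  ultimately show ?thesis using \<H>(3) by blast
qed

lemma cluster_point_in_compact:
  assumes "compactin T S" "frequently (\<lambda>y. y \<in> S) \<F>"
  shows "\<exists>x. cluster_point T \<F> x"
proof (rule ccontr)
  assume "\<nexists>x. cluster_point T \<F> x"
  then obtain G where "S \<subseteq> G" "eventually (\<lambda>y. y \<notin> G) \<F>"
    using no_cluster_point_in_compact[OF assms(1)] by blast
  then have "eventually (\<lambda>y. y \<notin> S) \<F>" by (auto elim: eventually_mono)
  then show False using assms(2) by (simp add: frequently_def)
qed

section \<open>Metrics with prescribed uniform covers\<close>

context Metric_space
begin

lemma metric_uniformityI:
  assumes "\<U> \<subseteq> Pow M" "\<epsilon> > 0" "\<And>x. x \<in> M \<Longrightarrow> \<exists>U\<in>\<U>. mball x \<epsilon> \<subseteq> U"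
  shows "\<U> \<in> metric_uniformity M d"
proof -
  have "M \<subseteq> \<Union>\<U>"
    using assms(2,3) by (meson UnionI centre_in_mball_iff subset_iff)
  then have "cover_of M \<U>" using assms(1) unfolding cover_of_def by blast
  moreover have "refines {mball x \<epsilon> |x. x \<in> M} \<U>" using assms(3) unfolding refines_def by blast
  ultimately show ?thesis unfolding metric_uniformity_def using assms(2) by blast
qed

lemma metric_uniformityD:
  assumes "\<U> \<in> metric_uniformity M d"
  shows "cover_of M \<U>" "\<exists>\<epsilon>>0. \<forall>x\<in>M. \<exists>U\<in>\<U>. mball x \<epsilon> \<subseteq> U"
  using assms unfolding metric_uniformity_def refines_def by blast+

lemma mballs_uniform:
  assumes "\<epsilon> > 0"
  shows "{mball x \<epsilon> |x. x \<in> M} \<in> metric_uniformity M d"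
  by (rule metric_uniformityI[OF _ assms]) auto

lemma open_cover_mballs:
  assumes "\<epsilon> > 0"
  shows "open_cover_of mtopology {mball x \<epsilon> |x. x \<in> M}"
  by (rule open_cover_ofI) (use assms in auto)

text \<open>The supremum of the radii \<open>t \<le> 1\<close> of balls about \<open>x\<close> inside \<open>G\<close>.  It plays the role of
  the distance from \<open>x\<close> to the complement of \<open>G\<close>, and needs no convention for \<open>G = M\<close>.  Balls
  about points outside \<open>M\<close> are empty, so the value is 1 there.\<close>

definition inradius :: "'a set \<Rightarrow> 'a \<Rightarrow> real" where
  "inradius G x = Sup {t. 0 \<le> t \<and> t \<le> 1 \<and> mball x t \<subseteq> G}"

lemma inradius_upper:
  assumes "0 \<le> t" "t \<le> 1" "mball x t \<subseteq> G"
  shows "t \<le> inradius G x"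
  unfolding inradius_def by (rule cSup_upper) (use assms in \<open>auto intro: bdd_aboveI[of _ 1]\<close>)

lemma inradius_least:
  assumes "\<And>t. 0 \<le> t \<Longrightarrow> t \<le> 1 \<Longrightarrow> mball x t \<subseteq> G \<Longrightarrow> t \<le> b"
  shows "inradius G x \<le> b"
  unfolding inradius_def
proof (rule cSup_least)
  have "0 \<in> {t. 0 \<le> t \<and> t \<le> 1 \<and> mball x t \<subseteq> G}" using mball_eq_empty[of x 0] by simp
  then show "{t. 0 \<le> t \<and> t \<le> 1 \<and> mball x t \<subseteq> G} \<noteq> {}" by blast
qed (use assms in auto)

lemma inradius_nonneg: "0 \<le> inradius G x"
  by (rule inradius_upper) (simp_all add: mball_eq_empty[THEN iffD2])

lemma inradius_le_1: "inradius G x \<le> 1"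
  by (rule inradius_least)

lemma inradius_Lipschitz:
  assumes "x \<in> M" "y \<in> M"
  shows "inradius G x \<le> inradius G y + d x y"
proof (rule inradius_least)
  fix t assume t: "0 \<le> t" "t \<le> 1" "mball x t \<subseteq> G"
  show "t \<le> inradius G y + d x y"
  proof (cases "d x y \<le> t")
    case True
    have "mball y (t - d x y) \<subseteq> mball x t"
      using assms triangle by fastforce
    moreover have "t - d x y \<le> 1" using t(2) nonneg[of x y] by linarith
    ultimately have "t - d x y \<le> inradius G y"
      by (intro inradius_upper) (use True t in auto)
    then show ?thesis by simp
  qed (use inradius_nonneg[of G y] in auto)
qed

lemma inradius_pos:
  assumes "openin mtopology G" "x \<in> G"
  shows "0 < inradius G x"
proof -
  obtain r where r: "r > 0" "mball x r \<subseteq> G" using assms by (auto simp: openin_mtopology)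
  have "mball x (min r 1) \<subseteq> mball x r" by auto
  then have "min r 1 \<le> inradius G x"
    by (intro inradius_upper) (use r in auto)
  then show ?thesis using r(1) by linarith
qed

lemma inradius_posD:
  assumes "x \<in> M" "0 < inradius G x"
  shows "x \<in> G"
proof (rule ccontr)
  assume "x \<notin> G"
  then have "inradius G x \<le> 0"
    using assms(1) by (intro inradius_least) (metis centre_in_mball_iff not_less subset_iff)
  then show False using assms(2) by simp
qed

lemma inradius_outside: "x \<notin> M \<Longrightarrow> inradius G x = 1"
  by (intro antisym inradius_le_1 inradius_upper) auto

text \<open>Adding to \<open>d\<close> the supremum of the pseudometrics of a pointwise equicontinuous family of
  functions does not change the topology.\<close>

lemma sup_metric:
  fixes \<Phi> :: "('a \<Rightarrow> real) set"
  assumes ne: "\<Phi> \<noteq> {}" and bd: "\<And>\<phi> x. \<phi> \<in> \<Phi> \<Longrightarrow> 0 \<le> \<phi> x \<and> \<phi> x \<le> 1"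
    and equi: "\<And>x \<epsilon>. x \<in> M \<Longrightarrow> 0 < \<epsilon> \<Longrightarrow>
      \<exists>\<delta>>0. \<forall>y\<in>M. d x y < \<delta> \<longrightarrow> (\<forall>\<phi>\<in>\<Phi>. \<bar>\<phi> x - \<phi> y\<bar> \<le> \<epsilon>)"
  obtains D where "Metric_space M D" "Metric_space.mtopology M D = mtopology"
    "\<And>\<phi> x y. \<phi> \<in> \<Phi> \<Longrightarrow> \<bar>\<phi> x - \<phi> y\<bar> \<le> D x y"
proof -
  define s where "s x y = (SUP \<phi>\<in>\<Phi>. \<bar>\<phi> x - \<phi> y\<bar>)" for x y
  define D where "D x y = d x y + s x y" for x y
  have s_upper: "\<bar>\<phi> x - \<phi> y\<bar> \<le> s x y" if "\<phi> \<in> \<Phi>" for \<phi> x y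
    unfolding s_def
  proof (rule cSUP_upper[OF that])
    have "\<bar>\<phi> x - \<phi> y\<bar> \<le> 1" if "\<phi> \<in> \<Phi>" for \<phi>
      using bd[OF that, of x] bd[OF that, of y] by linarith
    then show "bdd_above ((\<lambda>\<phi>. \<bar>\<phi> x - \<phi> y\<bar>) ` \<Phi>)" by (auto intro!: bdd_aboveI[of _ 1])
  qed
  have s_least: "s x y \<le> b" if "\<And>\<phi>. \<phi> \<in> \<Phi> \<Longrightarrow> \<bar>\<phi> x - \<phi> y\<bar> \<le> b" for x y b
    unfolding s_def by (rule cSUP_least[OF ne that])
  have s_nonneg: "0 \<le> s x y" for x y
  proof -
    obtain \<phi> where "\<phi> \<in> \<Phi>" using ne by blast
    then show ?thesis using s_upper[of \<phi> x y] by linarith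
  qed
  have s_refl: "s x x = 0" for x
    using s_least[of x x 0] s_nonneg[of x x] by simp
  have s_triangle: "s x z \<le> s x y + s y z" for x y z
  proof (rule s_least)
    fix \<phi> assume "\<phi> \<in> \<Phi>"
    then show "\<bar>\<phi> x - \<phi> z\<bar> \<le> s x y + s y z" using s_upper[of \<phi> x y] s_upper[of \<phi> y z] by linarith
  qed
  have D: "Metric_space M D"
  proof
    show "0 \<le> D x y" for x y unfolding D_def using s_nonneg[of x y] by simp
    show "D x y = D y x" for x y unfolding D_def s_def by (simp add: commute abs_minus_commute)
    show "D x y = 0 \<longleftrightarrow> x = y" if "x \<in> M" "y \<in> M" for x y
      using that s_nonneg[of x y] s_refl[of x] zero[OF that] nonneg[of x y] unfolding D_def
      by (metis add_nonneg_eq_0_iff)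
    show "D x z \<le> D x y + D y z" if "x \<in> M" "y \<in> M" "z \<in> M" for x y z
      using triangle[OF that] s_triangle[of x z y] unfolding D_def by linarith
  qed
  interpret D: Metric_space M D by (rule D)
  have "openin D.mtopology G \<longleftrightarrow> openin mtopology G" for G
  proof
    assume "openin mtopology G"
    moreover have "D.mball x r \<subseteq> mball x r" for x r
    proof
      fix y assume "y \<in> D.mball x r"
      then show "y \<in> mball x r" using s_nonneg[of x y] by (auto simp: D_def)
    qed
    ultimately show "openin D.mtopology G"
      unfolding openin_mtopology D.openin_mtopology by (meson order_trans)
  next
    assume G: "openin D.mtopology G"
    have "\<exists>r>0. mball x r \<subseteq> G" if "x \<in> G" for x
    proof -
      have x: "x \<in> M" using that G by (auto simp: D.openin_mtopology)
      obtain r where r: "r > 0" "D.mball x r \<subseteq> G"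
        using G \<open>x \<in> G\<close> by (auto simp: D.openin_mtopology)
      obtain \<delta> where \<delta>: "\<delta> > 0" "\<forall>y\<in>M. d x y < \<delta> \<longrightarrow> (\<forall>\<phi>\<in>\<Phi>. \<bar>\<phi> x - \<phi> y\<bar> \<le> r / 2)"
        using equi[OF x, of "r / 2"] r(1) by auto
      have "D x y < r" if "y \<in> M" "d x y < min \<delta> (r / 2)" for y
        using s_least[of x y "r / 2"] \<delta>(2) that unfolding D_def by fastforce
      then have "mball x (min \<delta> (r / 2)) \<subseteq> D.mball x r" using x by auto
      then show ?thesis using r \<delta>(1) by (intro exI[of _ "min \<delta> (r / 2)"]) auto
    qed
    then show "openin mtopology G" using G by (auto simp: openin_mtopology D.openin_mtopology)
  qed
  then have "D.mtopology = mtopology" by (simp add: topology_eq)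
  moreover have "\<bar>\<phi> x - \<phi> y\<bar> \<le> D x y" if "\<phi> \<in> \<Phi>" for \<phi> x y
    using s_upper[OF that, of x y] unfolding D_def by (simp add: add_increasing)
  ultimately show ?thesis using that D by blast
qed

text \<open>Every countable family of open covers is uniform for some compatible metric.  A cover
  \<open>\<U>\<close> contributes the functions \<open>f \<U> U\<close>, the inradius of \<open>U\<close> divided by the supremum of the
  inradii of all members: on \<open>M\<close> they vanish off \<open>U\<close>, have supremum 1 at every point, and are
  pointwise equicontinuous whether or not \<open>\<U>\<close> is locally finite.\<close>

lemma countable_open_covers_uniform:
  assumes count: "countable \<C>" and cov: "\<And>\<U>. \<U> \<in> \<C> \<Longrightarrow> open_cover_of mtopology \<U>"
  obtains D where "Metric_space M D" "Metric_space.mtopology M D = mtopology"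
    "\<C> \<subseteq> metric_uniformity M D"
proof (cases "M = {}")
  case True
  have "\<C> \<subseteq> metric_uniformity M d"
  proof
    fix \<U> assume "\<U> \<in> \<C>"
    then have "\<U> \<subseteq> Pow M" using cov unfolding open_cover_of_def cover_of_def by auto
    then show "\<U> \<in> metric_uniformity M d" by (rule metric_uniformityI[of _ 1]) (use True in auto)
  qed
  then show ?thesis using that Metric_space_axioms by blast
next
  case False
  have cov_Pow: "\<U> \<subseteq> Pow M" if "\<U> \<in> \<C>" for \<U>
    using cov[OF that] unfolding open_cover_of_def cover_of_def by auto
  have nonempty: "\<U> \<noteq> {}" if "\<U> \<in> \<C>" for \<U>
    using cov[OF that] False unfolding open_cover_of_def cover_of_def by auto
  define c where "c \<U> x = (SUP U\<in>\<U>. inradius U x)" for \<U> x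
  have c_upper: "inradius U x \<le> c \<U> x" if "U \<in> \<U>" for \<U> U x
    unfolding c_def by (rule cSUP_upper[OF that]) (auto intro!: bdd_aboveI[of _ 1] inradius_le_1)
  have c_Lipschitz: "c \<U> x \<le> c \<U> y + d x y" if "\<U> \<in> \<C>" "x \<in> M" "y \<in> M" for \<U> x y
    unfolding c_def[of \<U> x]
  proof (rule cSUP_least[OF nonempty[OF that(1)]])
    fix U assume "U \<in> \<U>"
    then show "inradius U x \<le> c \<U> y + d x y"
      using inradius_Lipschitz[OF that(2,3), of U] c_upper[of U \<U> y] by linarith
  qed
  have c_pos: "0 < c \<U> x" if \<U>: "\<U> \<in> \<C>" for \<U> x
  proof -
    obtain U where "U \<in> \<U>" "0 < inradius U x"
      using open_cover_ofD[OF cov[OF \<U>]] nonempty[OF \<U>] inradius_pos inradius_outside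
      by (metis all_not_in_conv topspace_mtopology zero_less_one)
    then show ?thesis using c_upper[of U \<U> x] by linarith
  qed
  define f where "f \<U> U x = inradius U x / c \<U> x" for \<U> U x
  have f_bounds: "0 \<le> f \<U> U x" "f \<U> U x \<le> 1" if "\<U> \<in> \<C>" "U \<in> \<U>" for \<U> U x
    using c_pos[OF that(1), of x] c_upper[OF that(2), of x] inradius_nonneg[of U x]
    unfolding f_def by simp_all
  have f_cont: "\<bar>f \<U> U x - f \<U> U y\<bar> \<le> 2 * d x y / c \<U> x"
    if "\<U> \<in> \<C>" "U \<in> \<U>" "x \<in> M" "y \<in> M" for \<U> U x y
  proof -
    have C: "0 < c \<U> x" "0 < c \<U> y" using c_pos that(1) by auto
    have 1: "\<bar>inradius U x - inradius U y\<bar> \<le> d x y" "\<bar>c \<U> y - c \<U> x\<bar> \<le> d x y"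
      using inradius_Lipschitz[of x y U] inradius_Lipschitz[of y x U]
        c_Lipschitz[OF that(1), of x y] c_Lipschitz[OF that(1), of y x] that commute[of x y] by auto
    have "f \<U> U x - f \<U> U y
        = ((inradius U x - inradius U y) + f \<U> U y * (c \<U> y - c \<U> x)) / c \<U> x"
      using C unfolding f_def by (simp add: field_simps)
    also have "\<bar>\<dots>\<bar> = \<bar>(inradius U x - inradius U y) + f \<U> U y * (c \<U> y - c \<U> x)\<bar> / c \<U> x"
      using C by simp
    also have "\<dots> \<le> (d x y + 1 * d x y) / c \<U> x"
    proof (rule divide_right_mono)
      have "\<bar>f \<U> U y * (c \<U> y - c \<U> x)\<bar> \<le> 1 * d x y"
        unfolding abs_mult using f_bounds[OF that(1,2), of y] 1(2) by (intro mult_mono) auto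
      then show "\<bar>(inradius U x - inradius U y) + f \<U> U y * (c \<U> y - c \<U> x)\<bar> \<le> d x y + 1 * d x y"
        using 1(1) by linarith
    qed (use C in simp)
    finally show ?thesis by simp
  qed
  \<comment> \<open>Weights tending to 0 along \<open>\<C>\<close> make the functions for all covers together equicontinuous.\<close>
  define w where "w \<U> = (1 / 2 :: real) ^ to_nat_on \<C> \<U>" for \<U>
  have w: "0 < w \<U>" "w \<U> \<le> 1" for \<U> unfolding w_def by (auto simp: power_le_one)
  define \<Phi> where "\<Phi> = insert (\<lambda>_. 0) {\<lambda>x. w \<U> * f \<U> U x |\<U> U. \<U> \<in> \<C> \<and> U \<in> \<U>}"
  have "\<exists>\<delta>>0. \<forall>y\<in>M. d x y < \<delta> \<longrightarrow> (\<forall>\<phi>\<in>\<Phi>. \<bar>\<phi> x - \<phi> y\<bar> \<le> \<epsilon>)"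
    if "x \<in> M" and \<epsilon>: "0 < \<epsilon>" for x \<epsilon>
  proof -
    obtain N where N: "(1 / 2 :: real) ^ N < \<epsilon>" using real_arch_pow_inv[OF \<epsilon>, of "1/2"] by auto
    define \<C>0 where "\<C>0 = {\<U> \<in> \<C>. to_nat_on \<C> \<U> < N}"
    have "finite (to_nat_on \<C> ` \<C>0)" unfolding \<C>0_def by (rule finite_subset[of _ "{..<N}"]) auto
    moreover have "inj_on (to_nat_on \<C>) \<C>0"
      using inj_on_to_nat_on[OF count] unfolding \<C>0_def by (rule inj_on_subset) auto
    ultimately have fin: "finite \<C>0" by (rule finite_imageD)
    define \<delta> where "\<delta> = Min (insert 1 ((\<lambda>\<U>. \<epsilon> * c \<U> x / 2) ` \<C>0))"
    have "\<delta> > 0" unfolding \<delta>_def using fin \<epsilon> c_pos by (auto simp: \<C>0_def)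
    moreover have "\<bar>\<phi> x - \<phi> y\<bar> \<le> \<epsilon>" if y: "y \<in> M" "d x y < \<delta>" and "\<phi> \<in> \<Phi>" for y \<phi>
      using \<open>\<phi> \<in> \<Phi>\<close> unfolding \<Phi>_def
    proof (elim insertE CollectE exE conjE)
      fix \<U> U assume \<U>: "\<phi> = (\<lambda>x. w \<U> * f \<U> U x)" "\<U> \<in> \<C>" "U \<in> \<U>"
      have eq: "\<bar>\<phi> x - \<phi> y\<bar> = w \<U> * \<bar>f \<U> U x - f \<U> U y\<bar>"
        unfolding \<U>(1) right_diff_distrib[symmetric] abs_mult using w(1)[of \<U>] by simp
      show ?thesis
      proof (cases "\<U> \<in> \<C>0")
        case True
        then have "\<delta> \<le> \<epsilon> * c \<U> x / 2" unfolding \<delta>_def using fin by (intro Min_le) auto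
        then have "2 * d x y / c \<U> x \<le> \<epsilon>"
          using y(2) c_pos[OF \<U>(2), of x] by (simp add: divide_le_eq)
        then have "\<bar>f \<U> U x - f \<U> U y\<bar> \<le> \<epsilon>"
          using f_cont[OF \<U>(2,3) \<open>x \<in> M\<close> y(1)] by linarith
        moreover have "w \<U> * \<bar>f \<U> U x - f \<U> U y\<bar> \<le> 1 * \<bar>f \<U> U x - f \<U> U y\<bar>"
          using w[of \<U>] by (intro mult_right_mono) auto
        ultimately show ?thesis unfolding eq by simp
      next
        case False
        then have "w \<U> \<le> (1 / 2) ^ N"
          unfolding w_def \<C>0_def using \<U>(2) by (intro power_decreasing) auto
        moreover have "\<bar>f \<U> U x - f \<U> U y\<bar> \<le> 1"
          using f_bounds[OF \<U>(2,3), of x] f_bounds[OF \<U>(2,3), of y] by linarith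
        then have "w \<U> * \<bar>f \<U> U x - f \<U> U y\<bar> \<le> w \<U> * 1"
          using w[of \<U>] by (intro mult_left_mono) auto
        ultimately show ?thesis unfolding eq using N by linarith
      qed
    qed (use \<open>0 < \<epsilon>\<close> in simp)
    ultimately show ?thesis by blast
  qed
  moreover have "0 \<le> \<phi> x \<and> \<phi> x \<le> 1" if "\<phi> \<in> \<Phi>" for \<phi> x
    using that unfolding \<Phi>_def
  proof (elim insertE CollectE exE conjE)
    fix \<U> U assume "\<phi> = (\<lambda>x. w \<U> * f \<U> U x)" "\<U> \<in> \<C>" "U \<in> \<U>"
    then show ?thesis using w[of \<U>] f_bounds[of \<U> U x] by (simp add: mult_le_one)
  qed simp
  ultimately obtain D where D: "Metric_space M D" "Metric_space.mtopology M D = mtopology"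
    "\<And>\<phi> x y. \<phi> \<in> \<Phi> \<Longrightarrow> \<bar>\<phi> x - \<phi> y\<bar> \<le> D x y"
    using sup_metric[of \<Phi>] unfolding \<Phi>_def by blast
  interpret D: Metric_space M D by (rule D(1))
  have "\<U> \<in> metric_uniformity M D" if \<U>: "\<U> \<in> \<C>" for \<U>
  proof (rule D.metric_uniformityI[OF cov_Pow[OF \<U>]])
    show "0 < w \<U> / 2" using w[of \<U>] by simp
    fix x assume x: "x \<in> M"
    \<comment> \<open>Choose \<open>U\<close> with \<open>f \<U> U x > 1 / 2\<close>: on a ball of radius \<open>w \<U> / 2\<close> the function
      \<open>f \<U> U\<close> stays positive.\<close>
    have "c \<U> x / 2 < c \<U> x" using c_pos[OF \<U>, of x] by simp
    then obtain U where U: "U \<in> \<U>" "c \<U> x / 2 < inradius U x"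
      unfolding c_def[of \<U> x] using nonempty[OF \<U>]
      by (meson less_cSUP_iff bdd_aboveI2 inradius_le_1)
    have "1 / 2 < f \<U> U x" unfolding f_def using U(2) c_pos[OF \<U>, of x] by (simp add: field_simps)
    have "D.mball x (w \<U> / 2) \<subseteq> U"
    proof
      fix y assume "y \<in> D.mball x (w \<U> / 2)"
      then have y: "y \<in> M" "D x y < w \<U> / 2" by auto
      have "(\<lambda>x. w \<U> * f \<U> U x) \<in> \<Phi>" unfolding \<Phi>_def using \<U> U(1) by blast
      then have "w \<U> * f \<U> U x - w \<U> * f \<U> U y < w \<U> / 2"
        using D(3)[of "\<lambda>x. w \<U> * f \<U> U x" x y] y(2) by linarith
      then have "w \<U> * (f \<U> U x - f \<U> U y) < w \<U> * (1 / 2)" by (simp add: algebra_simps)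
      then have "f \<U> U x - f \<U> U y < 1 / 2" using w(1)[of \<U>] by (simp only: mult_less_cancel_left_pos)
      then have "0 < f \<U> U y" using \<open>1 / 2 < f \<U> U x\<close> by linarith
      then have "0 < inradius U y"
        unfolding f_def using c_pos[OF \<U>, of y] by (simp add: zero_less_divide_iff)
      then show "y \<in> U" using inradius_posD[OF y(1)] by blast
    qed
    then show "\<exists>U\<in>\<U>. D.mball x (w \<U> / 2) \<subseteq> U" using U(1) by blast
  qed
  then show ?thesis using that D by blast
qed

text \<open>Rings between the level sets of a continuous function \<open>1 / g\<close> form a star-finite cover
  subordinate to a given increasing open cover.\<close>

lemma increasing_open_cover_star_finite_refinement:
  assumes op: "\<And>n. openin mtopology (Y n)" and inc: "\<And>n. Y n \<subseteq> Y (Suc n)"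
    and cov: "M \<subseteq> (\<Union>n. Y n)"
  obtains \<V> where "open_cover_of mtopology \<V>" "star_finite \<V>" "\<And>V. V \<in> \<V> \<Longrightarrow> \<exists>n. V \<subseteq> Y n"
proof -
  define h where "h n x = min (1 / (real n + 1)) (inradius (Y n) x)" for n x
  define g where "g x = (SUP n. h n x)" for x
  have h1: "h n x \<le> 1" for n x unfolding h_def using inradius_le_1[of "Y n" x] by simp
  have bdd: "bdd_above (range (\<lambda>n. h n x))" for x by (rule bdd_aboveI2[OF h1])
  have g_upper: "h n x \<le> g x" for n x unfolding g_def by (rule cSUP_upper[OF _ bdd]) simp
  have g_Lipschitz: "g x \<le> g y + d x y" if "x \<in> M" "y \<in> M" for x y
    unfolding g_def[of x]
  proof (rule cSUP_least)
    fix n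
    have "h n x \<le> h n y + d x y"
      using inradius_Lipschitz[OF that, of "Y n"] nonneg[of x y] unfolding h_def by linarith
    then show "h n x \<le> g y + d x y" using g_upper[of n y] by linarith
  qed simp
  have g_pos: "0 < g x" if "x \<in> M" for x
  proof -
    obtain n where "x \<in> Y n" using cov \<open>x \<in> M\<close> by blast
    then have "0 < h n x" unfolding h_def using inradius_pos[OF op] by simp
    then show ?thesis using g_upper[of n x] by linarith
  qed
  have Y_mono: "Y m \<subseteq> Y n" if "m \<le> n" for m n
    using that by (induction rule: dec_induct) (use inc in auto)
  have g_Y: "x \<in> Y n" if x: "x \<in> M" and gx: "1 / (real n + 1) < g x" for x n
  proof -
    obtain m where m: "1 / (real n + 1) < h m x"
      using gx less_cSUP_iff[OF _ bdd] unfolding g_def by blast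
    then have "1 / (real n + 1) < 1 / (real m + 1)" unfolding h_def by linarith
    then have "m \<le> n" by (simp add: field_simps)
    moreover have "0 < inradius (Y m) x"
      using m unfolding h_def by (smt (verit) divide_nonneg_nonneg of_nat_0_le_iff)
    then have "x \<in> Y m" using inradius_posD x by blast
    ultimately show ?thesis using Y_mono by blast
  qed
  define V where "V j = {x \<in> M. real j * g x < 1 \<and> 1 < (real j + 2) * g x}" for j
  have open_V: "openin mtopology (V j)" for j
    unfolding openin_mtopology
  proof (intro conjI allI impI)
    fix x assume "x \<in> V j"
    then have x: "x \<in> M" "real j * g x < 1" "1 < (real j + 2) * g x" unfolding V_def by auto
    define e where "e = min (1 - real j * g x) ((real j + 2) * g x - 1)"
    have e: "e > 0" unfolding e_def using x by simp
    have "y \<in> V j" if y: "y \<in> M" "d x y < e / (real j + 2)" for y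
    proof -
      have "(real j + 2) * d x y < e" using y(2) by (simp add: field_simps)
      moreover have "real j * d x y \<le> (real j + 2) * d x y" by (intro mult_right_mono) auto
      moreover have "real j * g y \<le> real j * (g x + d x y)"
        using g_Lipschitz[OF y(1) x(1)] commute[of x y] by (intro mult_left_mono) auto
      moreover have "(real j + 2) * g x \<le> (real j + 2) * (g y + d x y)"
        using g_Lipschitz[OF x(1) y(1)] by (intro mult_left_mono) auto
      ultimately show ?thesis
        unfolding V_def e_def using y(1) by (auto simp: distrib_left)
    qed
    then have "mball x (e / (real j + 2)) \<subseteq> V j" by auto
    then show "\<exists>r>0. mball x r \<subseteq> V j" using e by (intro exI[of _ "e / (real j + 2)"]) auto
  qed (auto simp: V_def)
  have meet: "i < j + 2" if x: "x \<in> V i" "x \<in> V j" for x i j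
  proof -
    have "x \<in> M" using x unfolding V_def by auto
    have "real i * g x < (real j + 2) * g x" using x unfolding V_def by auto
    then have "real i < real j + 2" using g_pos[OF \<open>x \<in> M\<close>] by (simp add: mult_less_cancel_right_pos)
    then show ?thesis by linarith
  qed
  show ?thesis
  proof (rule that[of "range V"])
    show "open_cover_of mtopology (range V)"
    proof (rule open_cover_ofI)
      fix x assume "x \<in> topspace mtopology"
      then have x: "x \<in> M" by simp
      define j where "j = nat \<lceil>1 / g x\<rceil> - 1"
      have "0 < 1 / g x" using g_pos[OF x] by simp
      then have "real j < 1 / g x" "1 / g x < real j + 2" unfolding j_def by linarith+
      then have "x \<in> V j" unfolding V_def using g_pos[OF x] x by (simp add: field_simps)
      then show "\<exists>U\<in>range V. x \<in> U" by blast
    qed (use open_V in auto)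
    show "star_finite (range V)"
      unfolding star_finite_def
    proof
      fix U assume "U \<in> range V"
      then obtain j where "U = V j" by blast
      then have "{W \<in> range V. W \<inter> U \<noteq> {}} \<subseteq> V ` {..<j + 2}" using meet by blast
      then show "finite {W \<in> range V. W \<inter> U \<noteq> {}}" by (rule finite_subset) simp
    qed
    fix U assume "U \<in> range V"
    then obtain j where "U = V j" by blast
    have "x \<in> Y (Suc j)" if "x \<in> V j" for x
      using that g_pos[of x] unfolding V_def by (intro g_Y) (auto simp: field_simps)
    then show "\<exists>n. U \<subseteq> Y n" using \<open>U = V j\<close> by blast
  qed
qed

end

section \<open>Covers of spaces that are locally compact off a compact set\<close>

text \<open>Contained in a compact set; in a Hausdorff space this says that the closure is compact.\<close>

definition relatively_compact :: "'a topology \<Rightarrow> 'a set \<Rightarrow> bool" where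
  "relatively_compact X G \<longleftrightarrow> (\<exists>S. compactin X S \<and> G \<subseteq> S)"

lemma relatively_compact_Union:
  assumes "finite \<G>" "\<And>G. G \<in> \<G> \<Longrightarrow> relatively_compact X G"
  shows "relatively_compact X (\<Union>\<G>)"
proof -
  obtain S where S: "\<And>G. G \<in> \<G> \<Longrightarrow> compactin X (S G) \<and> G \<subseteq> S G"
    using assms(2) unfolding relatively_compact_def by metis
  have "compactin X (\<Union>(S ` \<G>))" by (rule compactin_Union) (use assms(1) S in auto)
  moreover have "\<Union>\<G> \<subseteq> \<Union>(S ` \<G>)" using S by blast
  ultimately show ?thesis unfolding relatively_compact_def by blast
qed

lemma relatively_compact_subset:
  "relatively_compact X H \<Longrightarrow> G \<subseteq> H \<Longrightarrow> relatively_compact X G"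
  unfolding relatively_compact_def by blast

lemma relatively_compact_nbhd:
  assumes "x \<in> topspace X" "x \<notin> nlc X"
  shows "\<exists>G. openin X G \<and> relatively_compact X G \<and> x \<in> G"
  using assms unfolding nlc_def relatively_compact_def by blast

lemma finite_star_finite_meeting_relatively_compact:
  assumes "open_cover_of X \<U>" "star_finite \<U>" "relatively_compact X G"
  shows "finite {U \<in> \<U>. U \<inter> G \<noteq> {}}"
proof -
  obtain S where S: "compactin X S" "G \<subseteq> S" using assms(3) unfolding relatively_compact_def by blast
  show ?thesis
    by (rule finite_subset[OF _ finite_star_finite_meeting_compact[OF assms(1,2) S(1)]])
      (use S(2) in blast)
qed

lemma cluster_point_in_relatively_compact:
  assumes "relatively_compact T G" "frequently (\<lambda>y. y \<in> G) \<F>"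
  shows "\<exists>x. cluster_point T \<F> x"
proof -
  obtain S where S: "compactin T S" "G \<subseteq> S" using assms(1) unfolding relatively_compact_def by blast
  show ?thesis
    by (rule cluster_point_in_compact[OF S(1)], rule frequently_elim1[OF assms(2)]) (use S(2) in blast)
qed

text \<open>The cover by \<open>V\<close> and all relatively compact open sets; it is a cover as soon as \<open>V\<close>
  contains \<^term>\<open>nlc X\<close>.  Uniformity of these covers for all open neighbourhoods \<open>V\<close> of
  \<^term>\<open>nlc X\<close> expresses that the space is uniformly locally compact off every neighbourhood
  of \<^term>\<open>nlc X\<close>.\<close>

definition local_compactness_cover :: "'a topology \<Rightarrow> 'a set \<Rightarrow> 'a set set" where
  "local_compactness_cover X V = insert V {G. openin X G \<and> relatively_compact X G}"

lemma open_cover_local_compactness_cover: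
  assumes "openin X V" "nlc X \<subseteq> V"
  shows "open_cover_of X (local_compactness_cover X V)"
proof (rule open_cover_ofI)
  fix x assume "x \<in> topspace X"
  then show "\<exists>U\<in>local_compactness_cover X V. x \<in> U"
    using relatively_compact_nbhd[of x X] assms(2) unfolding local_compactness_cover_def by blast
qed (use assms(1) in \<open>auto simp: local_compactness_cover_def\<close>)

text \<open>The members of \<open>\<U>\<close> that are relatively compact off \<open>V\<close>.\<close>

definition compact_off :: "'a topology \<Rightarrow> 'a set \<Rightarrow> 'a set set \<Rightarrow> 'a set set" where
  "compact_off X V \<U> = {E \<in> \<U>. relatively_compact X (E - V)}"

text \<open>For nested covers that form a base, and an open \<open>V\<close> containing \<^term>\<open>nlc X\<close>, the unions of
  these subfamilies increase to the whole space.\<close>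

lemma compact_off_exhaustion:
  fixes \<U> :: "nat \<Rightarrow> 'a set set"
  assumes cov: "\<And>n. open_cover_of X (\<U> n)"
    and nested: "\<And>n E x. E \<in> \<U> n \<Longrightarrow> x \<in> E \<Longrightarrow> \<exists>E'\<in>\<U> (Suc n). x \<in> E' \<and> E' \<subseteq> E"
    and base: "\<And>G x. openin X G \<Longrightarrow> x \<in> G \<Longrightarrow> \<exists>n. \<exists>E\<in>\<U> n. x \<in> E \<and> E \<subseteq> G"
    and V: "openin X V" "nlc X \<subseteq> V"
  shows "openin X (\<Union>(compact_off X V (\<U> n)))"
    and "\<Union>(compact_off X V (\<U> n)) \<subseteq> \<Union>(compact_off X V (\<U> (Suc n)))"
    and "topspace X \<subseteq> (\<Union>n. \<Union>(compact_off X V (\<U> n)))"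
proof -
  show "openin X (\<Union>(compact_off X V (\<U> n)))"
    using open_cover_ofD(1)[OF cov] unfolding compact_off_def by blast
  show "\<Union>(compact_off X V (\<U> n)) \<subseteq> \<Union>(compact_off X V (\<U> (Suc n)))"
  proof
    fix x assume "x \<in> \<Union>(compact_off X V (\<U> n))"
    then obtain E where E: "E \<in> \<U> n" "x \<in> E" "relatively_compact X (E - V)"
      unfolding compact_off_def by blast
    then obtain E' where E': "E' \<in> \<U> (Suc n)" "x \<in> E'" "E' \<subseteq> E" using nested by blast
    have "relatively_compact X (E' - V)"
      by (rule relatively_compact_subset[OF E(3)]) (use E' in blast)
    then show "x \<in> \<Union>(compact_off X V (\<U> (Suc n)))"
      using E' unfolding compact_off_def by blast
  qed
  show "topspace X \<subseteq> (\<Union>n. \<Union>(compact_off X V (\<U> n)))"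
  proof
    fix x assume "x \<in> topspace X"
    then obtain G where G: "openin X G" "x \<in> G" "relatively_compact X (G - V)"
    proof (cases "x \<in> V")
      case True
      have "relatively_compact X (V - V)" unfolding relatively_compact_def by auto
      then show ?thesis using that V True by blast
    next
      case False
      then show ?thesis
        using that relatively_compact_nbhd[OF \<open>x \<in> topspace X\<close>] V(2) relatively_compact_subset
        by (metis Diff_subset subsetD)
    qed
    then obtain n E where E: "E \<in> \<U> n" "x \<in> E" "E \<subseteq> G" using base by blast
    have "relatively_compact X (E - V)"
      by (rule relatively_compact_subset[OF G(3)]) (use E in blast)
    then show "x \<in> (\<Union>n. \<Union>(compact_off X V (\<U> n)))"
      using E unfolding compact_off_def by blast
  qed
qed

context Metric_space
begin

lemma uniform_topology_eq: "uniform_topology M (metric_uniformity M d) = mtopology"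
  by (rule uniform_topology_metric_uniformity) (rule Metric_space_axioms)

lemma compact_nbhd_radius:
  assumes S: "compactin mtopology S" and V: "openin mtopology V" "S \<subseteq> V"
  shows "\<exists>k. (\<Union>c\<in>S. mball c (1 / real (Suc k))) \<subseteq> V"
proof -
  obtain \<epsilon> where \<epsilon>: "\<epsilon> > 0" "\<And>x. x \<in> S \<Longrightarrow> mball x \<epsilon> \<subseteq> V"
    using lebesgue_number[OF S, of "{V}"] V by auto
  obtain k where "1 / real (Suc k) < \<epsilon>"
    using reals_Archimedean[OF \<epsilon>(1)] by (auto simp: inverse_eq_divide)
  then have "mball c (1 / real (Suc k)) \<subseteq> V" if "c \<in> S" for c
    using \<epsilon>(2)[OF that] mball_subset_concentric[of "1 / real (Suc k)" \<epsilon> c] by simp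
  then show ?thesis by blast
qed

section \<open>Cofinal completeness\<close>

lemma cofinally_complete_if_uniformly_locally_compact:
  assumes K: "compactin mtopology (nlc mtopology)"
    and unif: "\<And>V. openin mtopology V \<Longrightarrow> nlc mtopology \<subseteq> V \<Longrightarrow>
      local_compactness_cover mtopology V \<in> metric_uniformity M d"
  shows "cofinally_complete M (metric_uniformity M d)"
  unfolding cofinally_complete_def uniform_topology_eq
proof (intro allI impI, rule ccontr)
  fix \<F> :: "'a filter"
  assume \<F>: "filter_on M \<F> \<and> cofinally_Cauchy (metric_uniformity M d) \<F>"
    and no: "\<nexists>x. cluster_point mtopology \<F> x"
  obtain V where V: "openin mtopology V" "nlc mtopology \<subseteq> V" "eventually (\<lambda>y. y \<notin> V) \<F>"
    using no_cluster_point_in_compact[OF K] no by blast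
  have "\<exists>U\<in>local_compactness_cover mtopology V. \<forall>F\<in>filter_sets \<F>. F \<inter> U \<noteq> {}"
    using conjunct2[OF \<F>] unif[OF V(1,2)] unfolding cofinally_Cauchy_def by (rule bspec)
  then obtain U where U: "U \<in> local_compactness_cover mtopology V"
    "\<And>F. F \<in> filter_sets \<F> \<Longrightarrow> F \<inter> U \<noteq> {}"
    by (elim bexE) (erule that, erule (1) bspec)
  have freq: "frequently (\<lambda>y. y \<in> U) \<F>"
  proof (rule ccontr)
    assume "\<not> frequently (\<lambda>y. y \<in> U) \<F>"
    then have "- U \<in> filter_sets \<F>" unfolding frequently_def filter_sets_def by simp
    then show False using U(2) by blast
  qed
  then have "U \<noteq> V" using V(3) unfolding frequently_def by blast
  then have "relatively_compact mtopology U" using U(1) unfolding local_compactness_cover_def by blast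
  then show False using cluster_point_in_relatively_compact[OF _ freq] no by blast
qed

end

section \<open>Construction of the metric\<close>

text \<open>The Bourbaki-completeness comes from making uniform, for each basic neighbourhood \<open>V k\<close> of
  \<^term>\<open>nlc X\<close>, a star-finite cover subordinate to the exhaustion of
  \<open>compact_off_exhaustion\<close>: a Bourbaki-Cauchy filter then lives on one level of the exhaustion
  and on finitely many members of the cover \<open>\<U> n\<close> of that level, which leaves only finitely many
  relatively compact sets off \<open>V k\<close>.\<close>

lemma (in Metric_space) complete_metric_exists:
  assumes str: "strongly_metrizable mtopology" and K: "compactin mtopology (nlc mtopology)"
  obtains D where "Metric_space M D" "Metric_space.mtopology M D = mtopology"
    "Bourbaki_complete M (metric_uniformity M D)"
    "\<And>V. openin mtopology V \<Longrightarrow> nlc mtopology \<subseteq> V \<Longrightarrow>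
      local_compactness_cover mtopology V \<in> metric_uniformity M D"
proof -
  obtain \<U> where \<U>: "\<And>n. open_cover_of mtopology (\<U> n)" "\<And>n. star_finite (\<U> n)"
    "\<And>n E x. E \<in> \<U> n \<Longrightarrow> x \<in> E \<Longrightarrow> \<exists>E'\<in>\<U> (Suc n). x \<in> E' \<and> E' \<subseteq> E"
    "\<And>G x. openin mtopology G \<Longrightarrow> x \<in> G \<Longrightarrow> \<exists>n. \<exists>E\<in>\<U> n. x \<in> E \<and> E \<subseteq> G"
    using strongly_metrizableE[OF str] by blast
  define V where "V k = (\<Union>c\<in>nlc mtopology. mball c (1 / real (Suc k)))" for k
  have V: "openin mtopology (V k)" "nlc mtopology \<subseteq> V k" for k
  proof -
    show "openin mtopology (V k)" unfolding V_def by blast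
    have "c \<in> mball c (1 / real (Suc k))" if "c \<in> nlc mtopology" for c
      using that unfolding nlc_def by auto
    then show "nlc mtopology \<subseteq> V k" unfolding V_def by blast
  qed
  have V_small: "\<exists>k. V k \<subseteq> W" if "openin mtopology W" "nlc mtopology \<subseteq> W" for W
    unfolding V_def by (rule compact_nbhd_radius[OF K that])
  define Y where "Y k n = \<Union>(compact_off mtopology (V k) (\<U> n))" for k n
  have "\<exists>\<V>. open_cover_of mtopology \<V> \<and> star_finite \<V> \<and> (\<forall>W\<in>\<V>. \<exists>n. W \<subseteq> Y k n)" for k
  proof (rule increasing_open_cover_star_finite_refinement[of "Y k"])
    show "openin mtopology (Y k n)" "Y k n \<subseteq> Y k (Suc n)" for n
      unfolding Y_def using compact_off_exhaustion(1,2)[of mtopology \<U>, OF \<U>(1,3,4) V] by auto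
    show "M \<subseteq> (\<Union>n. Y k n)"
      unfolding Y_def using compact_off_exhaustion(3)[of mtopology \<U>, OF \<U>(1,3,4) V] by simp
  qed blast
  then obtain \<V> where \<V>: "\<And>k. open_cover_of mtopology (\<V> k)" "\<And>k. star_finite (\<V> k)"
    "\<And>k W. W \<in> \<V> k \<Longrightarrow> \<exists>n. W \<subseteq> Y k n"
    by metis
  have Y_mono: "Y k m \<subseteq> Y k n" if "m \<le> n" for k m n
    using that
  proof (induction rule: dec_induct)
    case (step i)
    then show ?case
      unfolding Y_def using compact_off_exhaustion(2)[of mtopology \<U>, OF \<U>(1,3,4) V] by blast
  qed simp
  define \<C> where "\<C> = range \<U> \<union> range \<V> \<union> range (\<lambda>k. local_compactness_cover mtopology (V k))"
  have "countable \<C>" unfolding \<C>_def by simp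
  moreover have "open_cover_of mtopology \<W>" if "\<W> \<in> \<C>" for \<W>
    using that \<U>(1) \<V>(1) open_cover_local_compactness_cover[OF V] unfolding \<C>_def by auto
  ultimately obtain D where D: "Metric_space M D" "Metric_space.mtopology M D = mtopology"
    "\<C> \<subseteq> metric_uniformity M D"
    using countable_open_covers_uniform by metis
  interpret D: Metric_space M D by (rule D(1))
  have unif: "\<U> n \<in> metric_uniformity M D" "\<V> n \<in> metric_uniformity M D"
    "local_compactness_cover mtopology (V n) \<in> metric_uniformity M D" for n
    by (rule subsetD[OF D(3)], simp add: \<C>_def)+
  have "local_compactness_cover mtopology W \<in> metric_uniformity M D"
    if W: "openin mtopology W" "nlc mtopology \<subseteq> W" for W
  proof -
    obtain k where k: "V k \<subseteq> W" using V_small[OF W] by blast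
    obtain \<epsilon> where \<epsilon>: "\<epsilon> > 0"
      "\<And>x. x \<in> M \<Longrightarrow> \<exists>U\<in>local_compactness_cover mtopology (V k). D.mball x \<epsilon> \<subseteq> U"
      using D.metric_uniformityD(2)[OF unif(3)[of k]] by (elim exE conjE) (erule that, erule (1) bspec)
    show ?thesis
    proof (rule D.metric_uniformityI[OF _ \<epsilon>(1)])
      show "local_compactness_cover mtopology W \<subseteq> Pow M"
        using W(1) openin_subset unfolding local_compactness_cover_def by fastforce
      show "\<exists>U\<in>local_compactness_cover mtopology W. D.mball x \<epsilon> \<subseteq> U" if "x \<in> M" for x
        using \<epsilon>(2)[OF that] k unfolding local_compactness_cover_def by blast
    qed
  qed
  moreover have "Bourbaki_complete M (metric_uniformity M D)"
    unfolding Bourbaki_complete_def D.uniform_topology_eq D(2)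
  proof (intro allI impI, rule ccontr)
    fix \<F> :: "'a filter"
    assume \<F>: "filter_on M \<F> \<and> Bourbaki_Cauchy (metric_uniformity M D) \<F>"
      and no: "\<nexists>x. cluster_point mtopology \<F> x"
    obtain W where W: "openin mtopology W" "nlc mtopology \<subseteq> W" "eventually (\<lambda>y. y \<notin> W) \<F>"
    proof -
      have "\<exists>W. openin mtopology W \<and> nlc mtopology \<subseteq> W \<and> eventually (\<lambda>y. y \<notin> W) \<F>"
        by (rule no_cluster_point_in_compact[OF K]) (use no in simp)
      then show ?thesis by (elim exE conjE) (rule that)
    qed
    obtain k where k: "V k \<subseteq> W" using V_small[OF W(1,2)] by blast
    obtain \<T> where \<T>: "\<T> \<subseteq> \<V> k" "finite \<T>" "eventually (\<lambda>x. x \<in> \<Union>\<T>) \<F>"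
      using Bourbaki_Cauchy_star_finite[OF conjunct2[OF \<F>] unif(2)[of k] \<V>(2)[of k]]
      by (elim exE conjE) (rule that)
    obtain N where N: "\<And>W. W \<in> \<V> k \<Longrightarrow> W \<subseteq> Y k (N W)" using \<V>(3)[of _ k] by metis
    define n where "n = Max (N ` \<T>)"
    have n: "\<Union>\<T> \<subseteq> Y k n"
    proof (rule Union_least)
      fix W assume W: "W \<in> \<T>"
      have "N W \<le> n" unfolding n_def using \<T>(2) W by (intro Max_ge) auto
      then show "W \<subseteq> Y k n" using N[OF subsetD[OF \<T>(1) W]] Y_mono by (meson order_trans)
    qed
    obtain \<S> where \<S>: "\<S> \<subseteq> \<U> n" "finite \<S>" "eventually (\<lambda>x. x \<in> \<Union>\<S>) \<F>"
      using Bourbaki_Cauchy_star_finite[OF conjunct2[OF \<F>] unif(1)[of n] \<U>(2)[of n]]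
      by (elim exE conjE) (rule that)
    let ?\<H> = "{E \<in> compact_off mtopology (V k) (\<U> n). \<exists>S\<in>\<S>. E \<inter> S \<noteq> {}}"
    have "?\<H> \<subseteq> (\<Union>S\<in>\<S>. {E \<in> \<U> n. E \<inter> S \<noteq> {}})" unfolding compact_off_def by blast
    moreover have "finite (\<Union>S\<in>\<S>. {E \<in> \<U> n. E \<inter> S \<noteq> {}})"
      using \<S>(1,2) \<U>(2)[of n] unfolding star_finite_def by blast
    ultimately have "finite ?\<H>" by (rule finite_subset)
    then have "relatively_compact mtopology (\<Union>((\<lambda>E. E - V k) ` ?\<H>))"
      by (intro relatively_compact_Union) (auto simp: compact_off_def)
    moreover have "eventually (\<lambda>x. x \<in> \<Union>((\<lambda>E. E - V k) ` ?\<H>)) \<F>"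
      using \<T>(3) \<S>(3) W(3)
    proof eventually_elim
      case (elim x)
      then obtain E where "E \<in> compact_off mtopology (V k) (\<U> n)" "x \<in> E"
        using n unfolding Y_def by blast
      then show ?case using elim k by blast
    qed
    then have "frequently (\<lambda>x. x \<in> \<Union>((\<lambda>E. E - V k) ` ?\<H>)) \<F>"
      using \<F> unfolding filter_on_def by (intro eventually_frequently) auto
    ultimately show False using cluster_point_in_relatively_compact no by blast
  qed
  ultimately show ?thesis using that D by blast
qed

section \<open>Bases of sigma-star-finite uniform covers\<close>

lemma compactin_increasing_cover:
  fixes Y :: "nat \<Rightarrow> 'a set"
  assumes S: "compactin X S" "S \<subseteq> (\<Union>n. Y n)"
    and Y: "\<And>n. openin X (Y n)" "\<And>n. Y n \<subseteq> Y (Suc n)"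
  shows "\<exists>n. S \<subseteq> Y n"
proof -
  obtain \<F> where \<F>: "finite \<F>" "\<F> \<subseteq> range Y" "S \<subseteq> \<Union>\<F>"
    using S Y(1) unfolding compactin_def by (metis (no_types, lifting) imageE)
  obtain I where I: "finite I" "\<F> = Y ` I" using finite_subset_image[OF \<F>(1,2)] by blast
  have "Y i \<subseteq> Y (Max I)" if "i \<in> I" for i
    by (rule lift_Suc_mono_le[of Y, OF Y(2)]) (use I(1) that in simp)
  then show ?thesis using \<F>(3) I(2) by blast
qed

context Metric_space
begin

lemma maximal_separated_subset:
  fixes r :: real
  assumes "Y \<subseteq> M" "0 < r"
  obtains D where "D \<subseteq> Y" "\<And>x y. x \<in> D \<Longrightarrow> y \<in> D \<Longrightarrow> x \<noteq> y \<Longrightarrow> r \<le> d x y"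
    "\<And>x. x \<in> Y \<Longrightarrow> \<exists>y\<in>D. d x y < r"
proof -
  define \<A> where "\<A> = {D. D \<subseteq> Y \<and> (\<forall>x\<in>D. \<forall>y\<in>D. x \<noteq> y \<longrightarrow> r \<le> d x y)}"
  have "\<exists>D\<in>\<A>. \<forall>E\<in>\<A>. D \<subseteq> E \<longrightarrow> E = D"
  proof (rule subset_Zorn')
    fix \<C> assume ch: "subset.chain \<A> \<C>"
    then have sub: "\<And>D. D \<in> \<C> \<Longrightarrow> D \<subseteq> Y"
        "\<And>D x y. D \<in> \<C> \<Longrightarrow> x \<in> D \<Longrightarrow> y \<in> D \<Longrightarrow> x \<noteq> y \<Longrightarrow> r \<le> d x y"
      and lin: "\<And>D E. D \<in> \<C> \<Longrightarrow> E \<in> \<C> \<Longrightarrow> D \<subseteq> E \<or> E \<subseteq> D"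
      unfolding subset_chain_def \<A>_def by auto
    have "r \<le> d x y" if xy: "x \<in> \<Union>\<C>" "y \<in> \<Union>\<C>" "x \<noteq> y" for x y
    proof -
      obtain D E where DE: "D \<in> \<C>" "x \<in> D" "E \<in> \<C>" "y \<in> E" using xy by blast
      from lin[OF DE(1) DE(3)] show ?thesis
      proof
        assume "D \<subseteq> E" then show ?thesis using sub(2)[of E x y] DE xy(3) by blast
      next
        assume "E \<subseteq> D" then show ?thesis using sub(2)[of D x y] DE xy(3) by blast
      qed
    qed
    moreover have "\<Union>\<C> \<subseteq> Y" using sub(1) by (rule Union_least)
    ultimately show "\<Union>\<C> \<in> \<A>" unfolding \<A>_def by (intro CollectI conjI ballI impI)
  qed
  then obtain D where D: "D \<in> \<A>" "\<And>E. E \<in> \<A> \<Longrightarrow> D \<subseteq> E \<Longrightarrow> E = D" by blast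
  have "\<exists>y\<in>D. d x y < r" if x: "x \<in> Y" for x
  proof (rule ccontr)
    assume no: "\<not> (\<exists>y\<in>D. d x y < r)"
    then have "r \<le> d x y \<and> r \<le> d y x" if "y \<in> D" for y
      using that by (metis commute not_less)
    then have "insert x D \<in> \<A>" using D(1) x unfolding \<A>_def by blast
    then have "x \<in> D" using D(2) by blast
    moreover have "d x x < r" using x assms by auto
    ultimately show False using no by blast
  qed
  then show ?thesis using that[of D] D(1) unfolding \<A>_def by blast
qed

lemma compact_finite_ball_cover:
  assumes "compactin mtopology S" "0 < r"
  obtains F where "finite F" "F \<subseteq> S" "S \<subseteq> (\<Union>x\<in>F. mball x r)"
proof -
  have "\<exists>F. finite F \<and> F \<subseteq> S \<and> S \<subseteq> (\<Union>x\<in>F. mball x r)"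
    using compactin_imp_mtotally_bounded[OF assms(1)] assms(2) unfolding mtotally_bounded_def
    by (elim allE impE)
  then show ?thesis by (elim exE conjE) (rule that)
qed

lemma finite_separated_in_compact:
  fixes r :: real
  assumes S: "compactin mtopology S" and D: "D \<subseteq> S" and r: "0 < r"
    and sep: "\<And>x y. x \<in> D \<Longrightarrow> y \<in> D \<Longrightarrow> x \<noteq> y \<Longrightarrow> r \<le> d x y"
  shows "finite D"
proof -
  obtain F where F: "finite F" "F \<subseteq> S" "S \<subseteq> (\<Union>x\<in>F. mball x (r / 2))"
    using compact_finite_ball_cover[OF S half_gt_zero[OF r]] .
  have "\<forall>y\<in>D. \<exists>x\<in>F. y \<in> mball x (r / 2)" using F(3) D by blast
  then obtain f where f: "\<And>y. y \<in> D \<Longrightarrow> f y \<in> F \<and> y \<in> mball (f y) (r / 2)"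
    by metis
  have "inj_on f D"
  proof (rule inj_onI, rule ccontr)
    fix x y assume xy: "x \<in> D" "y \<in> D" "f x = f y" "x \<noteq> y"
    have "d x y \<le> d (f x) x + d (f x) y" using f[OF xy(1)] f[OF xy(2)] by (auto intro: triangle'')
    moreover have "d (f x) x < r / 2" "d (f x) y < r / 2" using f[OF xy(1)] f[OF xy(2)] xy(3) by auto
    ultimately show False using sep[OF xy(1,2,4)] by linarith
  qed
  moreover have "finite (f ` D)" by (rule finite_subset[OF _ F(1)]) (use f in blast)
  ultimately show ?thesis using finite_imageD by blast
qed

text \<open>A uniform cover by small balls: finitely many balls about points of \<^term>\<open>nlc mtopology\<close>,
  and a uniformly locally finite family of relatively compact balls about the points of a
  separated set \<open>D\<close>.  The latter family is the union of the subfamilies of those balls whose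
  concentric balls of twice the radius lie in the \<open>n\<close>-th level \<open>Y n\<close> of the exhaustion of
  \<open>compact_off_exhaustion\<close>.  Each subfamily is completed to a star-finite cover by the members
  of \<open>\<U> n\<close> that are relatively compact off \<open>V\<close>, which cover \<open>Y n\<close>, and by all members of
  \<open>\<U> n\<close> minus the closure \<open>Z n\<close> of the union of the subfamily, which is contained
  in \<open>Y n\<close>.\<close>

lemma sigma_star_finite_uniform_cover:
  assumes str: "strongly_metrizable mtopology" and K: "compactin mtopology (nlc mtopology)"
    and unif: "\<And>V. openin mtopology V \<Longrightarrow> nlc mtopology \<subseteq> V \<Longrightarrow>
      local_compactness_cover mtopology V \<in> metric_uniformity M d"
    and \<epsilon>: "0 < \<epsilon>"
  obtains \<W> where "\<W> \<in> metric_uniformity M d" "open_cover_of mtopology \<W>"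
    "sigma_star_finite mtopology \<W>" "\<And>W. W \<in> \<W> \<Longrightarrow> \<exists>x\<in>M. W \<subseteq> mball x \<epsilon>"
proof -
  obtain \<U> where \<U>: "\<And>n. open_cover_of mtopology (\<U> n)" "\<And>n. star_finite (\<U> n)"
    "\<And>n E x. E \<in> \<U> n \<Longrightarrow> x \<in> E \<Longrightarrow> \<exists>E'\<in>\<U> (Suc n). x \<in> E' \<and> E' \<subseteq> E"
    "\<And>G x. openin mtopology G \<Longrightarrow> x \<in> G \<Longrightarrow> \<exists>n. \<exists>E\<in>\<U> n. x \<in> E \<and> E \<subseteq> G"
    using strongly_metrizableE[OF str] by blast
  have KM: "nlc mtopology \<subseteq> M" using compactin_subset_topspace[OF K] by simp
  obtain C where C: "finite C" "C \<subseteq> nlc mtopology" "nlc mtopology \<subseteq> (\<Union>c\<in>C. mball c (\<epsilon> / 2))"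
    using compact_finite_ball_cover[OF K half_gt_zero[OF \<epsilon>]] .
  define V where "V = (\<Union>c\<in>nlc mtopology. mball c (\<epsilon> / 4))"
  have V: "openin mtopology V" "nlc mtopology \<subseteq> V"
    unfolding V_def using KM \<epsilon> by (auto intro!: bexI)
  obtain \<delta> where \<delta>: "\<delta> > 0"
    "\<And>x. x \<in> M \<Longrightarrow> \<exists>U\<in>local_compactness_cover mtopology V. mball x \<delta> \<subseteq> U"
    using metric_uniformityD(2)[OF unif[OF V]] by (elim exE conjE) (erule that, erule (1) bspec)
  define r where "r = min (\<delta> / 4) (\<epsilon> / 8)"
  have r: "0 < r" "4 * r \<le> \<delta>" "r \<le> \<epsilon> / 8" unfolding r_def using \<delta>(1) \<epsilon> by auto
  define Far where "Far = {y \<in> M. \<forall>c\<in>nlc mtopology. 3 * \<epsilon> / 8 \<le> d c y}"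
  obtain D where D: "D \<subseteq> Far" "\<And>x y. x \<in> D \<Longrightarrow> y \<in> D \<Longrightarrow> x \<noteq> y \<Longrightarrow> r / 2 \<le> d x y"
    "\<And>x. x \<in> Far \<Longrightarrow> \<exists>y\<in>D. d x y < r / 2"
    using maximal_separated_subset[of Far "r / 2"] r(1) unfolding Far_def by auto
  have DM: "D \<subseteq> M" using D(1) unfolding Far_def by blast
  have rc: "relatively_compact mtopology (mball y \<delta>)" if "y \<in> D" for y
  proof -
    have y: "y \<in> M" "y \<notin> V" using that D(1) \<epsilon> unfolding Far_def V_def by fastforce+
    obtain U where U: "U \<in> local_compactness_cover mtopology V" "mball y \<delta> \<subseteq> U"
      using \<delta>(2)[OF y(1)] by blast
    have "y \<in> U" using U(2) y(1) \<delta>(1) by auto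
    then have "relatively_compact mtopology U" using U(1) y(2) unfolding local_compactness_cover_def by blast
    then show ?thesis using relatively_compact_subset U(2) by blast
  qed
  \<comment> \<open>Points of \<open>Far\<close> have distance at least \<open>3 \<epsilon> / 8\<close> from \<open>nlc\<close>, points of \<open>V\<close> less than
    \<open>\<epsilon> / 4\<close> from some point of it, and \<open>r \<le> \<epsilon> / 8\<close>.\<close>
  have off_V: "mball y r \<inter> V = {}" if "y \<in> D" for y
  proof (rule ccontr)
    assume "mball y r \<inter> V \<noteq> {}"
    then obtain z c where z: "z \<in> M" "y \<in> M" "c \<in> M" "c \<in> nlc mtopology" "d y z < r" "d c z < \<epsilon> / 4"
      unfolding V_def by auto
    have "d c y \<le> d c z + d y z" using triangle' z(1-3) by blast
    then have "d c y < 3 * \<epsilon> / 8" using z r(3) by linarith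
    then show False using that D(1) z(4) unfolding Far_def by fastforce
  qed
  \<comment> \<open>All the balls about points of \<open>D\<close> that meet a given ball have centres within \<open>4 r \<le> \<delta>\<close> of
    any one of them, hence in a compact set.\<close>
  have fin_ball: "finite {y \<in> D. mball y r \<inter> mball x r \<noteq> {}}" (is "finite ?B") if x: "x \<in> M" for x
  proof (cases "?B = {}")
    case False
    then obtain y0 where y0: "y0 \<in> D" "mball y0 r \<inter> mball x r \<noteq> {}" by blast
    have "?B \<subseteq> mball y0 \<delta>"
    proof
      fix y assume y: "y \<in> ?B"
      obtain z w where zw: "z \<in> M" "w \<in> M" "d y0 z < r" "d x z < r" "d y w < r" "d x w < r"
        using y0(2) y by auto
      have yM: "y \<in> M" "y0 \<in> M" using y y0(1) DM by auto
      have "d y0 y \<le> d y0 x + d x y" "d y0 x \<le> d y0 z + d x z" "d x y \<le> d x w + d y w"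
        using triangle triangle' zw(1,2) yM x by blast+
      then have "d y0 y < \<delta>" using zw r(2) by linarith
      then show "y \<in> mball y0 \<delta>" using yM by simp
    qed
    moreover obtain S where "compactin mtopology S" "mball y0 \<delta> \<subseteq> S"
      using rc[OF y0(1)] unfolding relatively_compact_def by blast
    ultimately have "compactin mtopology S" "?B \<subseteq> S" by blast+
    then show ?thesis
      by (rule finite_separated_in_compact[of S ?B "r / 2"]) (use D(2) r(1) in simp_all)
  next
    case True
    then show ?thesis by (simp only: finite.emptyI)
  qed
  have fin_rc: "finite {y \<in> D. mball y r \<inter> G \<noteq> {}}" if G: "relatively_compact mtopology G" for G
  proof -
    obtain S where S: "compactin mtopology S" "G \<subseteq> S"
      using G unfolding relatively_compact_def by blast
    obtain F where F: "finite F" "F \<subseteq> S" "S \<subseteq> (\<Union>x\<in>F. mball x r)"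
      using compact_finite_ball_cover[OF S(1) r(1)] .
    have "F \<subseteq> M" using F(2) compactin_subset_topspace[OF S(1)] by auto
    then have "finite (\<Union>x\<in>F. {y \<in> D. mball y r \<inter> mball x r \<noteq> {}})"
      using F(1) fin_ball by blast
    moreover have "{y \<in> D. mball y r \<inter> G \<noteq> {}} \<subseteq> (\<Union>x\<in>F. {y \<in> D. mball y r \<inter> mball x r \<noteq> {}})"
      using S(2) F(3) by blast
    ultimately show ?thesis by (rule finite_subset[rotated])
  qed
  define \<W> where "\<W> = (\<lambda>c. mball c \<epsilon>) ` C \<union> (\<lambda>y. mball y r) ` D"
  have \<W>_unif: "\<W> \<in> metric_uniformity M d"
  proof (rule metric_uniformityI)
    show "0 < r / 2" using r by simp
    show "\<W> \<subseteq> Pow M" unfolding \<W>_def by auto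
    fix x assume x: "x \<in> M"
    show "\<exists>U\<in>\<W>. mball x (r / 2) \<subseteq> U"
    proof (cases "x \<in> Far")
      case True
      then obtain y where y: "y \<in> D" "d x y < r / 2" using D(3) by blast
      have "mball x (r / 2) \<subseteq> mball y r"
        by (rule mball_subset) (use y DM commute[of x y] in auto)
      then show ?thesis unfolding \<W>_def using y(1) by blast
    next
      case False
      then obtain k where k: "k \<in> nlc mtopology" "d k x < 3 * \<epsilon> / 8" using x unfolding Far_def by force
      then obtain c where c: "c \<in> C" "k \<in> mball c (\<epsilon> / 2)" using C(3) by blast
      have "d c x \<le> d c k + d k x" using c(2) x by (intro triangle) auto
      then have "d c x < 7 * \<epsilon> / 8" using c(2) k(2) by simp
      then have "mball x (r / 2) \<subseteq> mball c \<epsilon>"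
        by (intro mball_subset) (use c r commute[of x c] in auto)
      then show ?thesis unfolding \<W>_def using c(1) by blast
    qed
  qed
  have \<W>_open: "open_cover_of mtopology \<W>"
    using metric_uniformityD(1)[OF \<W>_unif] unfolding open_cover_of_def by (auto simp: \<W>_def)
  define Y where "Y n = \<Union>(compact_off mtopology V (\<U> n))" for n
  have Y: "openin mtopology (Y n)" "Y n \<subseteq> Y (Suc n)" "M \<subseteq> (\<Union>n. Y n)" for n
    unfolding Y_def using compact_off_exhaustion[of mtopology \<U>, OF \<U>(1,3,4) V] by auto
  define Dn where "Dn n = {y \<in> D. mball y (2 * r) \<subseteq> Y n}" for n
  define Z where "Z n = mtopology closure_of (\<Union>y\<in>Dn n. mball y r)" for n
  have ZY: "Z n \<subseteq> Y n" for n
  proof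
    fix z assume "z \<in> Z n"
    then obtain y w where yw: "y \<in> Dn n" "w \<in> mball y r" "w \<in> mball z r"
      unfolding Z_def metric_closure_of using r(1) by blast
    have "d y z \<le> d y w + d z w" using yw(2,3) by (intro triangle') auto
    then have "z \<in> mball y (2 * r)" using yw(2,3) by auto
    then show "z \<in> Y n" using yw(1) unfolding Dn_def by blast
  qed
  define \<V> where "\<V> n = (\<lambda>y. mball y r) ` Dn n \<union> compact_off mtopology V (\<U> n) \<union> (\<lambda>E. E - Z n) ` \<U> n" for n
  have \<V>_open: "open_cover_of mtopology (\<V> n)" for n
  proof (rule open_cover_ofI)
    fix U assume "U \<in> \<V> n"
    then show "openin mtopology U"
      unfolding \<V>_def compact_off_def using open_cover_ofD(1)[OF \<U>(1)]
      by (auto simp: Z_def intro!: openin_diff)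
  next
    fix x assume "x \<in> topspace mtopology"
    then obtain E where E: "E \<in> \<U> n" "x \<in> E" using open_cover_ofD(2)[OF \<U>(1)] by blast
    show "\<exists>U\<in>\<V> n. x \<in> U"
    proof (cases "x \<in> Y n")
      case True
      then show ?thesis unfolding Y_def \<V>_def by blast
    next
      case False
      then have "x \<in> E - Z n" using E(2) ZY by blast
      then show ?thesis unfolding \<V>_def using E(1) by blast
    qed
  qed
  have \<V>_fin: "finite {y \<in> Dn n. mball y r \<inter> U \<noteq> {}} \<and> finite {E \<in> \<U> n. E \<inter> U \<noteq> {}}"
    if "U \<in> \<V> n" for U n
  proof -
    have DnD: "{y \<in> Dn n. mball y r \<inter> G \<noteq> {}} \<subseteq> {y \<in> D. mball y r \<inter> G \<noteq> {}}" for G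
      unfolding Dn_def by blast
    consider y where "U = mball y r" "y \<in> Dn n" | "U \<in> compact_off mtopology V (\<U> n)"
      | E where "U = E - Z n" "E \<in> \<U> n"
      using \<open>U \<in> \<V> n\<close> unfolding \<V>_def by blast
    then show ?thesis
    proof cases
      case 1
      have "relatively_compact mtopology U"
        using rc[of y] 1 r(1,2) relatively_compact_subset mball_subset_concentric[of r \<delta> y]
        unfolding Dn_def by auto
      then show ?thesis
        using finite_star_finite_meeting_relatively_compact[OF \<U>(1,2)] finite_subset[OF DnD fin_rc]
        by blast
    next
      case 2
      then have "relatively_compact mtopology (U - V)" "U \<in> \<U> n" unfolding compact_off_def by auto
      moreover have "{y \<in> Dn n. mball y r \<inter> U \<noteq> {}} \<subseteq> {y \<in> D. mball y r \<inter> (U - V) \<noteq> {}}"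
        using off_V unfolding Dn_def by blast
      ultimately show ?thesis
        using fin_rc \<U>(2)[of n] unfolding star_finite_def by (meson finite_subset)
    next
      case 3
      have sub: "(\<Union>y\<in>Dn n. mball y r) \<subseteq> Z n"
        unfolding Z_def by (rule closure_of_subset) auto
      have "{y \<in> Dn n. mball y r \<inter> U \<noteq> {}} = {}" unfolding 3(1) using sub by blast
      moreover have "{E' \<in> \<U> n. E' \<inter> U \<noteq> {}} \<subseteq> {E' \<in> \<U> n. E' \<inter> E \<noteq> {}}" unfolding 3(1) by blast
      moreover have "finite {E' \<in> \<U> n. E' \<inter> E \<noteq> {}}"
        using \<U>(2)[of n] 3(2) unfolding star_finite_def by (rule bspec)
      ultimately have "finite {E' \<in> \<U> n. E' \<inter> U \<noteq> {}}" by (meson finite_subset)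
      then show ?thesis unfolding \<open>{y \<in> Dn n. mball y r \<inter> U \<noteq> {}} = {}\<close> by simp
    qed
  qed
  have \<V>_star: "star_finite (\<V> n)" for n
    unfolding star_finite_def
  proof
    fix U assume U: "U \<in> \<V> n"
    let ?A = "{y \<in> Dn n. mball y r \<inter> U \<noteq> {}}" and ?E = "{E \<in> \<U> n. E \<inter> U \<noteq> {}}"
    have "{W \<in> \<V> n. W \<inter> U \<noteq> {}} \<subseteq> (\<lambda>y. mball y r) ` ?A \<union> ?E \<union> (\<lambda>E. E - Z n) ` ?E"
      unfolding \<V>_def compact_off_def by blast
    then show "finite {W \<in> \<V> n. W \<inter> U \<noteq> {}}"
      by (rule finite_subset) (use \<V>_fin[OF U] in simp)
  qed
  have D_Dn: "\<exists>n. y \<in> Dn n" if y: "y \<in> D" for y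
  proof -
    obtain S where S: "compactin mtopology S" "mball y \<delta> \<subseteq> S"
      using rc[OF y] unfolding relatively_compact_def by blast
    have "S \<subseteq> (\<Union>n. Y n)" using compactin_subset_topspace[OF S(1)] Y(3) by auto
    then obtain n where "S \<subseteq> Y n"
      using compactin_increasing_cover[of mtopology S Y, OF S(1) _ Y(1,2)] by blast
    moreover have "mball y (2 * r) \<subseteq> mball y \<delta>" using r by (intro mball_subset_concentric) auto
    ultimately show ?thesis unfolding Dn_def using y S(2) by blast
  qed
  \<comment> \<open>The finitely many balls about points of \<open>nlc\<close> and \<open>M\<close> itself make up one more star-finite
    cover.\<close>
  define \<V>' where "\<V>' n = (case n of 0 \<Rightarrow> insert M ((\<lambda>c. mball c \<epsilon>) ` C) | Suc n \<Rightarrow> \<V> n)" for n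
  have "open_cover_of mtopology (insert M ((\<lambda>c. mball c \<epsilon>) ` C))"
    by (rule open_cover_ofI) auto
  moreover have "star_finite (insert M ((\<lambda>c. mball c \<epsilon>) ` C))"
    unfolding star_finite_def using C(1) by auto
  ultimately have "open_cover_of mtopology (\<V>' n) \<and> star_finite (\<V>' n)" for n
    unfolding \<V>'_def using \<V>_open \<V>_star by (simp split: nat.split)
  moreover have "\<W> \<subseteq> (\<Union>n. \<V>' n)"
  proof
    fix W assume "W \<in> \<W>"
    then consider "W \<in> \<V>' 0" | y where "W = mball y r" "y \<in> D" unfolding \<W>_def \<V>'_def by auto
    then show "W \<in> (\<Union>n. \<V>' n)"
    proof cases
      case 2
      then obtain n where "y \<in> Dn n" using D_Dn by blast
      then have "W \<in> \<V>' (Suc n)" unfolding \<V>'_def \<V>_def 2(1) by simp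
      then show ?thesis by blast
    qed blast
  qed
  ultimately have "sigma_star_finite mtopology \<W>" unfolding sigma_star_finite_def by blast
  moreover have "\<exists>x\<in>M. W \<subseteq> mball x \<epsilon>" if "W \<in> \<W>" for W
  proof -
    have "mball y r \<subseteq> mball y \<epsilon>" for y using r \<epsilon> by (intro mball_subset_concentric) auto
    then show ?thesis using that DM C(2) KM unfolding \<W>_def by blast
  qed
  ultimately show ?thesis using that \<W>_unif \<W>_open by blast
qed

lemma uniformly_completely_paracompact_if_uniformly_locally_compact:
  assumes str: "strongly_metrizable mtopology" and K: "compactin mtopology (nlc mtopology)"
    and unif: "\<And>V. openin mtopology V \<Longrightarrow> nlc mtopology \<subseteq> V \<Longrightarrow>
      local_compactness_cover mtopology V \<in> metric_uniformity M d"
  shows "uniformly_completely_paracompact M (metric_uniformity M d)"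
proof -
  let ?\<B> = "{\<W> \<in> metric_uniformity M d. open_cover_of mtopology \<W> \<and> sigma_star_finite mtopology \<W>}"
  have "\<exists>\<W>\<in>?\<B>. refines \<W> \<U>" if \<U>: "\<U> \<in> metric_uniformity M d" for \<U>
  proof -
    obtain \<epsilon> where \<epsilon>: "\<epsilon> > 0" "\<forall>x\<in>M. \<exists>U\<in>\<U>. mball x \<epsilon> \<subseteq> U"
      using metric_uniformityD(2)[OF \<U>] by blast
    show ?thesis
    proof (rule sigma_star_finite_uniform_cover[OF str K _ \<epsilon>(1)])
      fix \<W> assume \<W>: "\<W> \<in> metric_uniformity M d" "open_cover_of mtopology \<W>"
        "sigma_star_finite mtopology \<W>" "\<And>W. W \<in> \<W> \<Longrightarrow> \<exists>x\<in>M. W \<subseteq> mball x \<epsilon>"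
      have "refines \<W> \<U>" unfolding refines_def using \<epsilon>(2) \<W>(4) by (meson order_trans)
      then show ?thesis using \<W>(1-3) by blast
    qed (rule unif)
  qed
  then have \<B>: "uniformity_base (metric_uniformity M d) ?\<B>" unfolding uniformity_base_def by blast
  then show ?thesis
    unfolding uniformly_completely_paracompact_def uniform_topology_eq
    using cofinally_complete_if_uniformly_locally_compact[OF K unif] \<B> by blast
qed

lemma strongly_metrizable_if_uniformly_completely_paracompact:
  assumes "uniformly_completely_paracompact M (metric_uniformity M d)"
  shows "strongly_metrizable mtopology"
proof -
  obtain \<B> where \<B>: "uniformity_base (metric_uniformity M d) \<B>"
    "\<And>\<U>. \<U> \<in> \<B> \<Longrightarrow> open_cover_of mtopology \<U> \<and> sigma_star_finite mtopology \<U>"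
    using assms unfolding uniformly_completely_paracompact_def uniform_topology_eq by blast
  define b where "b n = {mball x (1 / real (Suc n)) |x. x \<in> M}" for n
  have "b n \<in> metric_uniformity M d" for n unfolding b_def by (rule mballs_uniform) simp
  then have "\<exists>\<V>\<in>\<B>. refines \<V> (b n)" for n using \<B>(1) unfolding uniformity_base_def by simp
  then obtain \<V> where \<V>: "\<And>n. \<V> n \<in> \<B>" "\<And>n. refines (\<V> n) (b n)"
    by metis
  have "\<exists>\<W>. (\<forall>k::nat. open_cover_of mtopology (\<W> k) \<and> star_finite (\<W> k)) \<and> \<V> n \<subseteq> (\<Union>k. \<W> k)" for n
    using \<B>(2)[OF \<V>(1)] unfolding sigma_star_finite_def by (rule conjunct2)
  then obtain \<W> :: "nat \<Rightarrow> nat \<Rightarrow> 'a set set"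
    where \<W>: "\<And>n k. open_cover_of mtopology (\<W> n k)" "\<And>n k. star_finite (\<W> n k)"
      "\<And>n. \<V> n \<subseteq> (\<Union>k. \<W> n k)"
    by metis
  show ?thesis
  proof (rule strongly_metrizableI[of mtopology \<W>, OF \<W>(1,2)])
    fix G x assume "openin mtopology G" "x \<in> G"
    then obtain r where r: "r > 0" "mball x r \<subseteq> G" "x \<in> M"
      unfolding openin_mtopology by (metis subsetD)
    obtain n where n: "1 / real (Suc n) < r / 2"
      using reals_Archimedean[of "r / 2"] r(1) by (auto simp: inverse_eq_divide)
    obtain W where W: "W \<in> \<V> n" "x \<in> W"
      using open_cover_ofD(2)[OF conjunct1[OF \<B>(2)[OF \<V>(1)]], of x n] r(3) by auto
    then obtain y where y: "W \<subseteq> mball y (1 / real (Suc n))" using \<V>(2)[of n] unfolding refines_def b_def by blast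
    have "W \<subseteq> mball x r"
    proof
      fix z assume "z \<in> W"
      then have z: "y \<in> M" "z \<in> M" "d y z < 1 / real (Suc n)" "d y x < 1 / real (Suc n)"
        using y W(2) by auto
      have "d x z \<le> d y x + d y z" using triangle''[OF r(3) z(1,2)] .
      then show "z \<in> mball x r" using z n r(3) by simp
    qed
    moreover obtain k where "W \<in> \<W> n k" using \<W>(3) W(1) by blast
    ultimately show "\<exists>n k. \<exists>V\<in>\<W> n k. x \<in> V \<and> V \<subseteq> G" using W(2) r(2) by blast
  qed
qed

end

section \<open>Compactness of the set of points without compact neighbourhood\<close>

lemma eventually_INF_directed_principal:
  assumes "B \<noteq> {}" "\<And>a b. a \<in> B \<Longrightarrow> b \<in> B \<Longrightarrow> \<exists>c\<in>B. A c \<subseteq> A a \<inter> A b"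
  shows "eventually P (INF b\<in>B. principal (A b)) \<longleftrightarrow> (\<exists>b\<in>B. \<forall>x\<in>A b. P x)"
proof -
  have "eventually P (INF b\<in>B. principal (A b)) \<longleftrightarrow> (\<exists>b\<in>B. eventually P (principal (A b)))"
    by (rule eventually_INF_base) (use assms in auto)
  then show ?thesis by (simp add: eventually_principal)
qed

lemma noncompact_closed_filter:
  assumes S: "closedin X S" "\<not> compactin X S"
  obtains \<F> where "\<F> \<noteq> bot" "eventually (\<lambda>y. y \<in> S) \<F>" "\<And>x. \<not> cluster_point X \<F> x"
proof -
  have "\<exists>\<U>. ((\<forall>U\<in>\<U>. openin X U) \<and> S \<subseteq> \<Union>\<U>) \<and> \<not> (\<exists>\<H>. finite \<H> \<and> \<H> \<subseteq> \<U> \<and> S \<subseteq> \<Union>\<H>)"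
  proof (rule ccontr)
    assume no: "\<not> ?thesis"
    have "compactin X S"
      unfolding compactin_def
    proof (intro conjI allI impI)
      fix \<U> assume \<U>: "(\<forall>U\<in>\<U>. openin X U) \<and> S \<subseteq> \<Union>\<U>"
      show "\<exists>\<H>. finite \<H> \<and> \<H> \<subseteq> \<U> \<and> S \<subseteq> \<Union>\<H>"
      proof (rule ccontr)
        assume "\<not> ?thesis"
        from no[THEN notE, OF exI, OF conjI, OF \<U> this] show False .
      qed
    qed (rule closedin_subset[OF S(1)])
    then show False using S(2) by contradiction
  qed
  then obtain \<U> where \<U>: "\<forall>U\<in>\<U>. openin X U" "S \<subseteq> \<Union>\<U>"
    "\<not> (\<exists>\<H>. finite \<H> \<and> \<H> \<subseteq> \<U> \<and> S \<subseteq> \<Union>\<H>)"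
    by (elim exE conjE) (rule that)
  define B where "B = {\<H>. finite \<H> \<and> \<H> \<subseteq> \<U>}"
  have dir: "\<exists>c\<in>B. S - \<Union>c \<subseteq> (S - \<Union>a) \<inter> (S - \<Union>b)" if "a \<in> B" "b \<in> B" for a b
    using that by (intro bexI[of _ "a \<union> b"]) (auto simp: B_def)
  have "{} \<in> B" unfolding B_def by simp
  then have "B \<noteq> {}" by blast
  define \<F> where "\<F> = (INF b\<in>B. principal (S - \<Union>b))"
  have \<F>: "eventually P \<F> \<longleftrightarrow> (\<exists>b\<in>B. \<forall>x\<in>S - \<Union>b. P x)" for P
    unfolding \<F>_def by (rule eventually_INF_directed_principal[OF \<open>B \<noteq> {}\<close> dir])
  show ?thesis
  proof (rule that[of \<F>])
    have "\<not> eventually (\<lambda>_. False) \<F>"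
      unfolding \<F> using \<U>(3) unfolding B_def by blast
    then show "\<F> \<noteq> bot" by auto
    show "eventually (\<lambda>y. y \<in> S) \<F>"
      unfolding \<F> using \<open>{} \<in> B\<close> by blast
    show "\<not> cluster_point X \<F> x" for x
    proof
      assume x: "cluster_point X \<F> x"
      show False
      proof (cases "x \<in> S")
        case True
        then obtain U where U: "U \<in> \<U>" "x \<in> U" using \<U>(2) by blast
        then have "{U} \<in> B" unfolding B_def by simp
        then have "eventually (\<lambda>y. y \<notin> U) \<F>" unfolding \<F> by (rule bexI[rotated]) simp
        then show False using cluster_pointD[OF x bspec[OF \<U>(1) U(1)] U(2)] by contradiction
      next
        case False
        have "eventually (\<lambda>y. y \<notin> topspace X - S) \<F>" unfolding \<F> using \<open>{} \<in> B\<close> by blast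
        moreover have "x \<in> topspace X - S" using x False unfolding cluster_point_def by simp
        moreover have "openin X (topspace X - S)" using S(1) by (simp add: closedin_def)
        ultimately show False using cluster_pointD[OF x] by blast
      qed
    qed
  qed
qed

lemma closedin_nlc: "closedin X (nlc X)"
proof -
  have "topspace X - nlc X = \<Union>{U. openin X U \<and> relatively_compact X U}"
    using openin_subset unfolding nlc_def relatively_compact_def by fastforce
  also have "openin X \<dots>" by blast
  finally show ?thesis unfolding closedin_def nlc_def by auto
qed

context Metric_space
begin

lemma nlc_filter:
  assumes "x \<in> nlc mtopology" "0 < r"
  obtains \<F> where "\<F> \<noteq> bot" "eventually (\<lambda>y. y \<in> mball x r) \<F>" "\<And>z. \<not> cluster_point mtopology \<F> z"
proof -
  have x: "x \<in> M" using assms(1) unfolding nlc_def by simp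
  have "\<not> compactin mtopology (mcball x (r / 2))"
  proof
    assume "compactin mtopology (mcball x (r / 2))"
    moreover have "x \<in> mball x (r / 2)" using x assms(2) by simp
    ultimately show False
      using assms(1) mball_subset_mcball[of x "r / 2"] openin_mball[of x "r / 2"]
      unfolding nlc_def by blast
  qed
  then obtain \<F> where \<F>: "\<F> \<noteq> bot" "eventually (\<lambda>y. y \<in> mcball x (r / 2)) \<F>"
    "\<And>z. \<not> cluster_point mtopology \<F> z"
    using noncompact_closed_filter[OF closedin_mcball] by metis
  have "eventually (\<lambda>y. y \<in> mball x r) \<F>"
    using \<F>(2) by (rule eventually_mono) (use assms(2) in auto)
  then show ?thesis using that \<F>(1,3) by blast
qed

lemma noncompact_closed_sequence:
  assumes S: "closedin mtopology S" "\<not> compactin mtopology S"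
  obtains \<sigma> :: "nat \<Rightarrow> 'a"
  where "\<And>n. \<sigma> n \<in> S" "\<And>x. x \<in> M \<Longrightarrow> \<exists>r>0. finite {n. \<sigma> n \<in> mball x r}"
proof -
  have SM: "S \<subseteq> M" using closedin_subset[OF S(1)] by simp
  then obtain T where T: "T \<subseteq> S" "infinite T" "S \<inter> mtopology derived_set_of T = {}"
    using S(2) compactin_eq_Bolzano_Weierstrass[of S] by auto
  obtain \<sigma> :: "nat \<Rightarrow> 'a" where \<sigma>: "inj \<sigma>" "range \<sigma> \<subseteq> T"
    using infinite_countable_subset[OF T(2)] by blast
  have "\<exists>r>0. finite {n. \<sigma> n \<in> mball x r}" if x: "x \<in> M" for x
  proof (cases "x \<in> S")
    case True
    then have "x \<notin> mtopology derived_set_of T" using T(3) by blast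
    then obtain r where r: "r > 0" "\<And>y. y \<in> T \<Longrightarrow> y \<in> mball x r \<Longrightarrow> y = x"
      unfolding metric_derived_set_of using x by blast
    have "{n. \<sigma> n \<in> mball x r} \<subseteq> \<sigma> -` {x}"
      using r(2)[OF subsetD[OF \<sigma>(2) rangeI]] by blast
    moreover have "finite (\<sigma> -` {x})" using \<sigma>(1) by (simp add: finite_vimageI)
    ultimately have "finite {n. \<sigma> n \<in> mball x r}" by (rule finite_subset)
    then show ?thesis using r(1) by blast
  next
    case False
    have "openin mtopology (M - S)" using S(1) by (simp add: closedin_def)
    then obtain r where r: "r > 0" "mball x r \<subseteq> M - S"
      using False x unfolding openin_mtopology by blast
    then have "{n. \<sigma> n \<in> mball x r} = {}" using \<sigma>(2) T(1) by blast
    then show ?thesis using r(1) by (metis finite.emptyI)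
  qed
  then show ?thesis using that[of \<sigma>] \<sigma>(2) T(1) by blast
qed

text \<open>If \<^term>\<open>nlc mtopology\<close> were not compact, it would contain a sequence \<open>\<sigma>\<close> without cluster
  points; filters without cluster points concentrated on ever smaller balls about the points
  \<open>\<sigma> n\<close> have a supremum that is cofinally Cauchy and still has no cluster point.\<close>

lemma compact_nlc_if_cofinally_complete:
  assumes "cofinally_complete M (metric_uniformity M d)"
  shows "compactin mtopology (nlc mtopology)"
proof (rule ccontr)
  assume "\<not> compactin mtopology (nlc mtopology)"
  then obtain \<sigma> :: "nat \<Rightarrow> 'a" where \<sigma>: "\<And>n. \<sigma> n \<in> nlc mtopology"
    "\<And>x. x \<in> M \<Longrightarrow> \<exists>r>0. finite {n. \<sigma> n \<in> mball x r}"
    using noncompact_closed_sequence[OF closedin_nlc] by metis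
  have \<sigma>M: "\<sigma> n \<in> M" for n using \<sigma>(1)[of n] unfolding nlc_def by simp
  have "\<exists>\<F>. \<F> \<noteq> bot \<and> eventually (\<lambda>y. y \<in> mball (\<sigma> n) (1 / real (Suc n))) \<F>
      \<and> (\<forall>z. \<not> cluster_point mtopology \<F> z)" for n
    by (rule nlc_filter[OF \<sigma>(1), of "1 / real (Suc n)" n]) (simp, blast)
  then obtain \<G> where \<G>: "\<And>n. \<G> n \<noteq> bot"
    "\<And>n. eventually (\<lambda>y. y \<in> mball (\<sigma> n) (1 / real (Suc n))) (\<G> n)"
    "\<And>n z. \<not> cluster_point mtopology (\<G> n) z"
    by metis
  define \<F> where "\<F> = (SUP n. \<G> n)"
  have ev: "eventually P \<F> \<longleftrightarrow> (\<forall>n. eventually P (\<G> n))" for P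
    unfolding \<F>_def by (simp add: eventually_Sup)
  have "\<F> \<noteq> bot" using \<G>(1)[of 0] ev[of "\<lambda>_. False"] by (auto simp: trivial_limit_def)
  moreover have "eventually (\<lambda>y. y \<in> M) \<F>"
    unfolding ev by (intro allI eventually_mono[OF \<G>(2)]) auto
  ultimately have "filter_on M \<F>" unfolding filter_on_def by simp
  moreover have "cofinally_Cauchy (metric_uniformity M d) \<F>"
    unfolding cofinally_Cauchy_def
  proof
    fix \<U> assume "\<U> \<in> metric_uniformity M d"
    then obtain \<epsilon> where \<epsilon>: "\<epsilon> > 0" "\<And>x. x \<in> M \<Longrightarrow> \<exists>U\<in>\<U>. mball x \<epsilon> \<subseteq> U"
      using metric_uniformityD(2) by meson
    obtain n where n: "1 / real (Suc n) < \<epsilon>"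
      using reals_Archimedean[OF \<epsilon>(1)] by (auto simp: inverse_eq_divide)
    obtain U where U: "U \<in> \<U>" "mball (\<sigma> n) \<epsilon> \<subseteq> U" using \<epsilon>(2)[OF \<sigma>M] by blast
    have "F \<inter> U \<noteq> {}" if "F \<in> filter_sets \<F>" for F
    proof -
      have "eventually (\<lambda>y. y \<in> F) (\<G> n)" using that ev unfolding filter_sets_def by simp
      then have "eventually (\<lambda>y. y \<in> F \<and> y \<in> mball (\<sigma> n) (1 / real (Suc n))) (\<G> n)"
        using \<G>(2) by (rule eventually_conj)
      then obtain y where y: "y \<in> F" "y \<in> mball (\<sigma> n) (1 / real (Suc n))"
        using eventually_happens'[OF \<G>(1)] by blast
      then have "y \<in> mball (\<sigma> n) \<epsilon>" using n by auto
      then show ?thesis using y(1) U(2) by blast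
    qed
    then show "\<exists>U\<in>\<U>. \<forall>F\<in>filter_sets \<F>. F \<inter> U \<noteq> {}" using U(1) by blast
  qed
  ultimately obtain x where x: "cluster_point mtopology \<F> x"
    using assms unfolding cofinally_complete_def uniform_topology_eq by blast
  then have xM: "x \<in> M" unfolding cluster_point_def by simp
  \<comment> \<open>For \<open>n\<close> outside a finite set \<open>N\<close> the ball carrying \<open>\<G> n\<close> misses the ball of radius \<open>r / 2\<close>
    about \<open>x\<close>; for the remaining \<open>n\<close> the point \<open>x\<close> is not a cluster point of \<open>\<G> n\<close>.\<close>
  obtain r where r: "r > 0" "finite {n. \<sigma> n \<in> mball x r}" using \<sigma>(2)[OF xM] by blast
  obtain m where m: "1 / real (Suc m) < r / 2"
    using reals_Archimedean[of "r / 2"] r(1) by (auto simp: inverse_eq_divide)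
  define N where "N = {n. \<sigma> n \<in> mball x r} \<union> {..<m}"
  have N: "finite N" unfolding N_def using r(2) by simp
  have "\<exists>G. openin mtopology G \<and> x \<in> G \<and> eventually (\<lambda>y. y \<notin> G) (\<G> n)" for n
    by (rule not_cluster_pointD[OF \<G>(3)]) (use xM in simp)
  then obtain G where G: "\<And>n. openin mtopology (G n)" "\<And>n. x \<in> G n"
    "\<And>n. eventually (\<lambda>y. y \<notin> G n) (\<G> n)"
    by metis
  define H where "H = mball x (r / 2) \<inter> (\<Inter>n\<in>insert 0 N. G n)"
  have "openin mtopology H"
    unfolding H_def by (intro openin_Int openin_mball openin_Inter) (use N G(1) in auto)
  moreover have "x \<in> H" unfolding H_def using G(2) xM r(1) by simp
  moreover have "eventually (\<lambda>y. y \<notin> H) \<F>"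
    unfolding ev
  proof
    fix n
    show "eventually (\<lambda>y. y \<notin> H) (\<G> n)"
    proof (cases "n \<in> N")
      case True
      show ?thesis using G(3)[of n] by (rule eventually_mono) (use True in \<open>auto simp: H_def\<close>)
    next
      case False
      then have n: "\<not> d x (\<sigma> n) < r" "m \<le> n" using xM \<sigma>M unfolding N_def by auto
      have "1 / real (Suc n) \<le> 1 / real (Suc m)" using n(2) by (simp add: field_simps)
      then have n3: "1 / real (Suc n) < r / 2" using m by linarith
      show ?thesis
        using \<G>(2)[of n]
      proof (rule eventually_mono)
        fix y assume y: "y \<in> mball (\<sigma> n) (1 / real (Suc n))"
        show "y \<notin> H"
        proof
          assume "y \<in> H"
          then have "d x y < r / 2" "y \<in> M" unfolding H_def by auto
          moreover have "d (\<sigma> n) y < 1 / real (Suc n)" using y by simp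
          moreover have "d x (\<sigma> n) \<le> d x y + d (\<sigma> n) y" by (rule triangle'[OF xM \<open>y \<in> M\<close> \<sigma>M])
          ultimately show False using n(1) n3 by linarith
        qed
      qed
    qed
  qed
  ultimately show False using cluster_pointD[OF x] by blast
qed

end

section \<open>Bourbaki-completeness implies strong metrizability\<close>

text \<open>Rings of iterated stars about one base point in each chain component form a star-finite
  open cover.\<close>

lemma star_finite_ring_cover:
  assumes \<U>: "open_cover_of X \<U>"
  obtains \<G> where "open_cover_of X \<G>" "star_finite \<G>"
    "\<And>G. G \<in> \<G> \<Longrightarrow> \<exists>p\<in>topspace X. \<exists>m. G \<subseteq> (star \<U> ^^ m) {p}"
proof -
  define A where "A p j = (star \<U> ^^ j) {p}" for p j
  have A0: "A p 0 = {p}" and A_Suc: "A p (Suc j) = star \<U> (A p j)" for p j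
    unfolding A_def by simp_all
  have star_open: "openin X (star \<U> B)" for B
    unfolding star_def using open_cover_ofD(1)[OF \<U>] by blast
  have star_upper: "B \<subseteq> star \<U> B" if "B \<subseteq> topspace X" for B
    using open_cover_ofD(2)[OF \<U>] that unfolding star_def by blast
  have star_closure: "X closure_of B \<subseteq> star \<U> B" for B
  proof
    fix x assume x: "x \<in> X closure_of B"
    then obtain U where U: "U \<in> \<U>" "x \<in> U"
      using open_cover_ofD(2)[OF \<U>] by (auto simp: in_closure_of)
    then have "U \<inter> B \<noteq> {}" using x open_cover_ofD(1)[OF \<U> U(1)] by (auto simp: in_closure_of)
    then show "x \<in> star \<U> B" using U unfolding star_def by blast
  qed
  have A_top: "A p j \<subseteq> topspace X" if "p \<in> topspace X" for p j
    by (cases j) (use that openin_subset[OF star_open] in \<open>auto simp: A0 A_Suc\<close>)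
  have A_mono: "A p i \<subseteq> A p j" if "p \<in> topspace X" "i \<le> j" for p i j
    by (rule lift_Suc_mono_le[of "A p", OF _ that(2)])
      (use star_upper[OF A_top[OF that(1)]] in \<open>simp add: A_Suc\<close>)
  \<comment> \<open>Iterated stars of points are images under powers of a symmetric relation \<open>R\<close>, and the chain
    components \<open>C p\<close> are the classes of its reflexive transitive closure.\<close>
  define R where "R = {(x, y). \<exists>U\<in>\<U>. x \<in> U \<and> y \<in> U}"
  have "sym R" unfolding R_def sym_def by blast
  have star_R: "star \<U> B = R `` B" for B unfolding star_def R_def by blast
  have A_R: "A p j = (R ^^ j) `` {p}" for p j
    by (induction j) (auto simp: A0 A_Suc star_R relcomp_Image)
  define C where "C p = R\<^sup>* `` {p}" for p
  have C_A: "C p = (\<Union>j. A p j)" for p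
    unfolding C_def A_R rtrancl_power[abs_def] by (auto simp: rtrancl_power)
  have C_refl: "p \<in> C p" for p unfolding C_def by simp
  have C_eq: "C p = C q" if "x \<in> C p" "x \<in> C q" for x p q
  proof -
    have "sym (R\<^sup>*)" by (rule sym_rtrancl[OF \<open>sym R\<close>])
    then have "(p, q) \<in> R\<^sup>*" "(q, p) \<in> R\<^sup>*"
      using that unfolding C_def by (auto dest: symD intro: rtrancl_trans)
    then show ?thesis unfolding C_def by (auto intro: rtrancl_trans)
  qed
  define rep where "rep p = (SOME q. q \<in> C p)" for p
  have rep: "rep p \<in> C p" for p unfolding rep_def by (rule someI) (rule C_refl)
  have C_rep: "C (rep p) = C p" for p using C_eq[OF C_refl rep] .
  have rep_top: "rep p \<in> topspace X" if "p \<in> topspace X" for p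
    using rep[of p] A_top[OF that] unfolding C_A by blast
  have rep_eq: "rep p = rep q" if "x \<in> C (rep p)" "x \<in> C (rep q)" for x p q
  proof -
    have "C p = C q" using C_eq[OF that] by (simp only: C_rep)
    then show ?thesis unfolding rep_def by simp
  qed
  \<comment> \<open>As the closure of \<open>A p i\<close> lies in \<open>A p (i + 1)\<close>, removing the closure two steps back still
    leaves a cover, while rings whose indices differ by 2 or more are disjoint.\<close>
  define ring where
    "ring p j = A p (Suc j) - (if j = 0 then {} else X closure_of (A p (j - 1)))" for p j
  define \<G> where "\<G> = {ring (rep p) j |p j. p \<in> topspace X}"
  have ring_C: "ring p j \<subseteq> C p" for p j unfolding ring_def C_A by blast
  have ring_meet: "i < j + 2" if x: "x \<in> ring p i" "x \<in> ring p j" and p: "p \<in> topspace X" for x p i j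
  proof (rule ccontr)
    assume "\<not> i < j + 2"
    then have ij: "Suc j \<le> i - 1" "i \<noteq> 0" by auto
    have "x \<in> A p (i - 1)" using x(2) A_mono[OF p ij(1)] unfolding ring_def by blast
    moreover have "A p (i - 1) \<subseteq> X closure_of (A p (i - 1))"
      by (rule closure_of_subset[OF A_top[OF p]])
    ultimately show False using x(1) ij(2) unfolding ring_def by auto
  qed
  show ?thesis
  proof (rule that[of \<G>])
    show "open_cover_of X \<G>"
    proof (rule open_cover_ofI)
      fix U assume "U \<in> \<G>"
      then show "openin X U"
        unfolding \<G>_def ring_def A_Suc using star_open by (auto intro!: openin_diff)
    next
      fix x assume x: "x \<in> topspace X"
      define q where "q = rep x"
      have q: "q \<in> topspace X" unfolding q_def by (rule rep_top[OF x])
      have "x \<in> C q" unfolding q_def C_rep by (rule C_refl)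
      then obtain k where "x \<in> A q k" unfolding C_A by blast
      define j where "j = (LEAST j. x \<in> A q j)"
      have j: "x \<in> A q j" unfolding j_def by (rule LeastI) fact
      have below: "x \<notin> A q i" if "i < j" for i using not_less_Least that unfolding j_def by blast
      have "x \<in> ring q (j - 1)"
      proof (cases j)
        case 0
        then show ?thesis using j A_mono[OF q, of 0 1] unfolding ring_def by auto
      next
        case (Suc i)
        have "x \<notin> X closure_of (A q (i - 1))" if "i \<noteq> 0"
          using below[of i] star_closure[of "A q (i - 1)"] A_Suc[of q "i - 1"] that Suc by auto
        then show ?thesis using j Suc unfolding ring_def by auto
      qed
      then show "\<exists>U\<in>\<G>. x \<in> U" unfolding \<G>_def q_def using x by blast
    qed
    show "star_finite \<G>"
      unfolding star_finite_def
    proof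
      fix U assume "U \<in> \<G>"
      then obtain p i where U: "U = ring (rep p) i" "p \<in> topspace X" unfolding \<G>_def by blast
      have "{V \<in> \<G>. V \<inter> U \<noteq> {}} \<subseteq> ring (rep p) ` {..<i + 2}"
      proof
        fix V assume "V \<in> {V \<in> \<G>. V \<inter> U \<noteq> {}}"
        then obtain q j x where V: "V = ring (rep q) j" "x \<in> V" "x \<in> U" unfolding \<G>_def by blast
        have "rep q = rep p"
          by (rule rep_eq[of x]) (use V U(1) ring_C in blast)+
        then show "V \<in> ring (rep p) ` {..<i + 2}"
          using ring_meet[of x "rep p" j i] V U rep_top by auto
      qed
      then show "finite {V \<in> \<G>. V \<inter> U \<noteq> {}}" by (rule finite_subset) simp
    qed
    show "\<exists>p\<in>topspace X. \<exists>m. G \<subseteq> (star \<U> ^^ m) {p}" if G\<G>: "G \<in> \<G>" for G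
    proof -
      obtain p j where G: "G = ring (rep p) j" "p \<in> topspace X" using G\<G> unfolding \<G>_def by blast
      have "G \<subseteq> (star \<U> ^^ Suc j) {rep p}" unfolding G(1) ring_def A_def by blast
      then show ?thesis using rep_top[OF G(2)] by blast
    qed
  qed
qed

text \<open>In the proof, \<open>\<G> n\<close> is a ring cover at scale \<open>1 / (n + 1)\<close>.  If no intersection \<open>D n\<close> of
  members \<open>G i\<close> of \<open>\<G> i\<close>, \<open>i \<le> n\<close>, were covered by finitely many balls of a fixed radius, then the
  sets \<open>D n\<close> minus finitely many such balls would generate a Bourbaki-Cauchy filter without
  cluster point.  So common refinements of the \<open>\<G> n\<close> have members about every point that split
  into finitely many small sets.\<close>

lemma (in Metric_space) strongly_metrizable_if_Bourbaki_complete: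
  assumes "Bourbaki_complete M (metric_uniformity M d)"
  shows "strongly_metrizable mtopology"
proof -
  define b where "b n = {mball x (1 / real (Suc n)) |x. x \<in> M}" for n
  have "open_cover_of mtopology (b n)" for n unfolding b_def by (rule open_cover_mballs) simp
  then have "\<exists>\<G>. open_cover_of mtopology \<G> \<and> star_finite \<G> \<and>
      (\<forall>G\<in>\<G>. \<exists>p\<in>M. \<exists>m. G \<subseteq> (star (b n) ^^ m) {p})" for n
    using star_finite_ring_cover[of mtopology "b n"] by (metis topspace_mtopology)
  then obtain \<G> where \<G>: "\<And>n. open_cover_of mtopology (\<G> n)" "\<And>n. star_finite (\<G> n)"
    "\<And>n G. G \<in> \<G> n \<Longrightarrow> \<exists>p\<in>M. \<exists>m. G \<subseteq> (star (b n) ^^ m) {p}"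
    by metis
  define W where "W = common_refinement \<G>"
  have W: "open_cover_of mtopology (W n)" "star_finite (W n)" for n
    unfolding W_def using common_refinement_open_cover[of mtopology \<G>, OF \<G>(1)]
      common_refinement_star_finite[of \<G>, OF \<G>(2)] by auto
  define small_cover where
    "small_cover k E C \<longleftrightarrow> finite C \<and> C \<subseteq> M \<and> E \<subseteq> (\<Union>c\<in>C. mball c (1 / real (Suc k)))" for k E C
  have key: "\<exists>n. \<exists>E\<in>W n. x \<in> E \<and> (\<exists>C. small_cover k E C)" if x: "x \<in> M" for x k
  proof (rule ccontr)
    assume no: "\<not> (\<exists>n. \<exists>E\<in>W n. x \<in> E \<and> (\<exists>C. small_cover k E C))"
    have "\<exists>G. G \<in> \<G> n \<and> x \<in> G" for n using open_cover_ofD(2)[OF \<G>(1), of x n] x by auto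
    then obtain G where G: "\<And>n. G n \<in> \<G> n" "\<And>n. x \<in> G n" by metis
    define D where "D n = (\<Inter>i\<le>n. G i)" for n
    have D_W: "D n \<in> W n" for n
      unfolding D_def W_def by (rule Inter_in_common_refinement[of G \<G>, OF G(1)])
    have D_x: "x \<in> D n" for n unfolding D_def using G(2) by simp
    define B where "B = (UNIV :: nat set) \<times> {C. finite C \<and> C \<subseteq> M}"
    define A where "A = (\<lambda>(n, C). D n - (\<Union>c\<in>C. mball c (1 / real (Suc k))))"
    have dir: "\<exists>c\<in>B. A c \<subseteq> A a \<inter> A a'" if aa': "a \<in> B" "a' \<in> B" for a a'
    proof -
      obtain n C n' C' where eq: "a = (n, C)" "a' = (n', C')" by fastforce
      have "D (max n n') \<subseteq> D n \<inter> D n'" unfolding D_def by (auto simp: le_max_iff_disj)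
      then have "A (max n n', C \<union> C') \<subseteq> A a \<inter> A a'" unfolding A_def eq by auto
      moreover have "(max n n', C \<union> C') \<in> B" using aa' unfolding B_def eq by auto
      ultimately show ?thesis by blast
    qed
    have B0: "(n, {}) \<in> B" for n unfolding B_def by simp
    then have "B \<noteq> {}" by blast
    define \<F> where "\<F> = (INF a\<in>B. principal (A a))"
    have \<F>: "eventually P \<F> \<longleftrightarrow> (\<exists>a\<in>B. \<forall>y\<in>A a. P y)" for P
      unfolding \<F>_def by (rule eventually_INF_directed_principal[OF \<open>B \<noteq> {}\<close> dir])
    have ev_D: "eventually (\<lambda>y. y \<in> D n) \<F>" for n
      unfolding \<F> by (rule bexI[OF _ B0[of n]]) (simp add: A_def)
    have "A a \<noteq> {}" if aB: "a \<in> B" for a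
    proof -
      obtain n C where a: "a = (n, C)" "finite C" "C \<subseteq> M" using aB unfolding B_def by blast
      have "\<not> small_cover k (D n) C" using no D_W D_x by blast
      then show ?thesis using a(2,3) unfolding small_cover_def A_def a(1) by auto
    qed
    then have "\<not> eventually (\<lambda>_. False) \<F>" unfolding \<F> by blast
    then have "\<F> \<noteq> bot" by auto
    moreover have "eventually (\<lambda>y. y \<in> M) \<F>"
      using ev_D[of 0] by (rule eventually_mono)
        (use openin_subset[OF open_cover_ofD(1)[OF \<G>(1) G(1)], of 0] in \<open>auto simp: D_def\<close>)
    ultimately have "filter_on M \<F>" unfolding filter_on_def by simp
    moreover have "Bourbaki_Cauchy (metric_uniformity M d) \<F>"
      unfolding Bourbaki_Cauchy_def
    proof
      fix \<U> assume \<U>: "\<U> \<in> metric_uniformity M d"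
      then obtain \<epsilon> where \<epsilon>: "\<epsilon> > 0" "\<And>x. x \<in> M \<Longrightarrow> \<exists>U\<in>\<U>. mball x \<epsilon> \<subseteq> U"
        using metric_uniformityD(2) by meson
      obtain n where n: "1 / real (Suc n) < \<epsilon>"
        using reals_Archimedean[OF \<epsilon>(1)] by (auto simp: inverse_eq_divide)
      have "mball y (1 / real (Suc n)) \<subseteq> mball y \<epsilon>" for y
        using n by (intro mball_subset_concentric) simp
      then have "\<exists>U\<in>\<U>. mball y (1 / real (Suc n)) \<subseteq> U" if "y \<in> M" for y
        using \<epsilon>(2)[OF that] by (meson order_trans)
      then have ref: "refines (b n) \<U>" unfolding refines_def b_def by blast
      obtain p m where p: "p \<in> M" "G n \<subseteq> (star (b n) ^^ m) {p}"
        using \<G>(3)[OF G(1)[of n]] by (elim bexE exE) (rule that)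
      obtain U where U: "U \<in> \<U>" "p \<in> U"
        using metric_uniformityD(1)[OF \<U>] p(1) unfolding cover_of_def by blast
      have "G n \<subseteq> (star \<U> ^^ m) U"
        using order_trans[OF p(2) star_pow_mono[OF ref, of "{p}" U m]] U(2) by simp
      moreover have "G n \<in> filter_sets \<F>"
        unfolding filter_sets_def mem_Collect_eq using ev_D[of n]
        by (rule eventually_mono) (simp add: D_def)
      ultimately show "\<exists>m. \<exists>U\<in>\<U>. \<exists>F\<in>filter_sets \<F>. F \<subseteq> (star \<U> ^^ m) U" using U(1) by blast
    qed
    ultimately obtain z where z: "cluster_point mtopology \<F> z"
      using assms unfolding Bourbaki_complete_def uniform_topology_eq by blast
    then have "z \<in> M" unfolding cluster_point_def by simp
    have "(0, {z}) \<in> B" unfolding B_def using \<open>z \<in> M\<close> by simp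
    then have "eventually (\<lambda>y. y \<notin> mball z (1 / real (Suc k))) \<F>"
      unfolding \<F> by (rule bexI[rotated]) (simp add: A_def)
    then show False
      using cluster_pointD[OF z openin_mball, of z "1 / real (Suc k)"] \<open>z \<in> M\<close> by simp
  qed
  define Cs where "Cs k E = (SOME C. small_cover k E C)" for k E
  have Cs: "small_cover k E (Cs k E)" if "\<exists>C. small_cover k E C" for k E
    using someI_ex[OF that] unfolding Cs_def .
  define P where "P k E = (if \<exists>C. small_cover k E C
      then (\<lambda>c. E \<inter> mball c (1 / real (Suc k))) ` Cs k E else {E})" for k E
  have P: "finite (P k E)" "\<Union>(P k E) = E" for k E
    using Cs[of k E] unfolding P_def small_cover_def by auto
  have P_open: "openin mtopology V" if "openin mtopology E" "V \<in> P k E" for k E V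
    using that openin_mball unfolding P_def by (auto split: if_splits)
  define \<V> where "\<V> n k = (\<Union>E\<in>W n. P k E)" for n k
  have P_open_W: "openin mtopology V" if "E \<in> W n" "V \<in> P k E" for n k E V
    by (rule P_open[OF open_cover_ofD(1)[OF W(1) that(1)] that(2)])
  have \<V>: "open_cover_of mtopology (\<V> n k)" "star_finite (\<V> n k)" for n k
    unfolding \<V>_def by (rule star_finite_subdivide[OF W P P_open_W], assumption+)+
  show ?thesis
  proof (rule strongly_metrizableI[of mtopology \<V>, OF \<V>])
    fix G x assume "openin mtopology G" "x \<in> G"
    then obtain r where r: "r > 0" "mball x r \<subseteq> G" "x \<in> M"
      unfolding openin_mtopology by (metis subsetD)
    obtain k where k: "1 / real (Suc k) < r / 2"
      using reals_Archimedean[of "r / 2"] r(1) by (auto simp: inverse_eq_divide)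
    obtain n E where E: "E \<in> W n" "x \<in> E" "\<exists>C. small_cover k E C" using key[OF r(3)] by blast
    then obtain c where c: "c \<in> Cs k E" "x \<in> mball c (1 / real (Suc k))"
      using Cs[OF E(3)] unfolding small_cover_def by blast
    define V where "V = E \<inter> mball c (1 / real (Suc k))"
    have "V \<in> \<V> n k" unfolding \<V>_def P_def V_def using E(1,3) c(1) by auto
    moreover have "x \<in> V" unfolding V_def using E(2) c(2) by blast
    moreover have "V \<subseteq> mball x r"
    proof
      fix z assume "z \<in> V"
      then have z: "c \<in> M" "z \<in> M" "d c z < 1 / real (Suc k)" "d c x < 1 / real (Suc k)"
        using c(2) unfolding V_def by auto
      have "d x z \<le> d c x + d c z" using triangle''[OF r(3) z(1,2)] .
      then show "z \<in> mball x r" using z k r(3) by simp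
    qed
    ultimately show "\<exists>n k. \<exists>V\<in>\<V> n k. x \<in> V \<and> V \<subseteq> G" using r(2) by blast
  qed
qed

section \<open>The equivalence\<close>

theorem theorem2p2p22:
  fixes X :: "'a topology"
  assumes "metrizable_space X"
  shows "((\<exists>d. metrizes d X \<and>
             uniformly_completely_paracompact (topspace X) (metric_uniformity (topspace X) d))
          \<longleftrightarrow> (strongly_metrizable X \<and> compactin X (nlc X)))
       \<and> ((strongly_metrizable X \<and> compactin X (nlc X))
          \<longleftrightarrow> (\<exists>d. metrizes d X \<and>
             Bourbaki_complete (topspace X) (metric_uniformity (topspace X) d) \<and>
             cofinally_complete (topspace X) (metric_uniformity (topspace X) d)))"
proof -
  define M where "M = topspace X"
  have to_strong: "strongly_metrizable X \<and> compactin X (nlc X)"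
    if d: "metrizes d X"
      and d_complete: "uniformly_completely_paracompact M (metric_uniformity M d)
        \<or> Bourbaki_complete M (metric_uniformity M d) \<and> cofinally_complete M (metric_uniformity M d)"
    for d
  proof -
    have top: "Metric_space M d" "Metric_space.mtopology M d = X"
      using d unfolding metrizes_def M_def by simp_all
    interpret Metric_space M d by (rule top(1))
    have "strongly_metrizable mtopology"
      using d_complete strongly_metrizable_if_uniformly_completely_paracompact
        strongly_metrizable_if_Bourbaki_complete by argo
    moreover have "compactin mtopology (nlc mtopology)"
      by (rule compact_nlc_if_cofinally_complete)
        (use d_complete in \<open>auto simp: uniformly_completely_paracompact_def\<close>)
    ultimately show ?thesis unfolding top(2) by (rule conjI)
  qed
  have from_strong: "\<exists>d. metrizes d X \<and> uniformly_completely_paracompact M (metric_uniformity M d)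
      \<and> Bourbaki_complete M (metric_uniformity M d) \<and> cofinally_complete M (metric_uniformity M d)"
    if X: "strongly_metrizable X" "compactin X (nlc X)"
  proof -
    obtain N d where Nd: "Metric_space N d" "X = Metric_space.mtopology N d"
      using assms unfolding metrizable_space_def by blast
    then have N: "N = M" unfolding M_def by (simp add: Metric_space.topspace_mtopology)
    have top: "Metric_space M d" "Metric_space.mtopology M d = X" using Nd unfolding N by simp_all
    show ?thesis
    proof (rule Metric_space.complete_metric_exists[OF top(1), unfolded top(2), OF X])
      fix D assume D: "Metric_space M D" "Metric_space.mtopology M D = X"
        "Bourbaki_complete M (metric_uniformity M D)"
        "\<And>V. openin X V \<Longrightarrow> nlc X \<subseteq> V \<Longrightarrow> local_compactness_cover X V \<in> metric_uniformity M D"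
      have "metrizes D X" unfolding metrizes_def M_def[symmetric] using D(1,2) by (rule conjI)
      moreover have ucp: "uniformly_completely_paracompact M (metric_uniformity M D)"
        by (rule Metric_space.uniformly_completely_paracompact_if_uniformly_locally_compact[
              OF D(1), unfolded D(2), OF X D(4)])
      moreover have "cofinally_complete M (metric_uniformity M D)"
        using ucp unfolding uniformly_completely_paracompact_def by (rule conjunct1)
      ultimately show ?thesis using D(3) by blast
    qed
  qed
  show ?thesis
    unfolding M_def[symmetric] using to_strong from_strong by blast
qed

end
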